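(* Let $n\ge0$. The space of holomorphic sections $\mathcal{E}_{-n}^{\rm hol}=\{\sigma\in\mathcal{E}_{-n}: D\sigma\in\Omega^{1,0}\bar\otimes\mathcal{E}_{-n}\}$ of the charge $-n$ $q$-monopole bundle contains the standard $(n+1)$-dimensional corepresentation of $\mathbb{C}_q[SL_2]$, namely $\mathrm{span}\{c^sa^t: s+t=n,\ s,t\ge0\}$ with left coaction given by restriction of the coproduct.
   Context: $q\in\mathbb{C}$ is invertible, $[n;q^2]=(1-q^{2n})/(1-q^2)$; $\bar\otimes$ is the tensor product over $\mathbb{C}_q[S^2]$. $\mathbb{C}_q[SL_2]$ is the Hopf algebra generated by $a,b,c,d$ with $ba=qab$, $ca=qac$, $db=qbd$, $dc=qcd$, $bc=cb$, $ad=1+q^{-1}bc$, $da=1+qbc$ and matrix coproduct. It is $\mathbb{Z}$-graded by $\deg a=\deg c=1$, $\deg b=\deg d=-1$; $\mathbb{C}_q[SL_2]_n$ is the degree $n$ component, and the coproduct restricts to a left coaction of $\mathbb{C}_q[SL_2]$ on each $\mathbb{C}_q[SL_2]_n$. $\mathbb{C}_q[S^2]=\mathbb{C}_q[SL_2]_0$. $\Omega^1(\mathbb{C}_q[SL_2])$ is the bimodule calculus that is free as a left module on $e^+,e^-,e^0$, with $e^\pm x=q^{\deg x}x\,e^\pm$ and $e^0x=q^{2\deg x}x\,e^0$ for homogeneous $x$, and $$\mathrm{d}a=ae^0+qbe^+,\quad \mathrm{d}b=ae^--q^{-2}be^0,\quad \mathrm{d}c=ce^0+qde^+,\quad \mathrm{d}d=ce^--q^{-2}de^0.$$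 $\Omega^1(\mathbb{C}_q[S^2])=\mathrm{span}\{m\,\mathrm{d}m': m,m'\in\mathbb{C}_q[S^2]\}=\Omega^{1,0}\oplus\Omega^{0,1}$ with $\Omega^{1,0}=\mathbb{C}_q[SL_2]_{-2}e^+$, $\Omega^{0,1}=\mathbb{C}_q[SL_2]_2e^-$. The sections of the charge $-n$ $q$-monopole bundle are $\mathcal{E}_{-n}=\mathbb{C}_q[SL_2]_n$, with covariant derivative of the $q$-monopole connection $D\sigma=\mathrm{d}\sigma-[n;q^2]\sigma e^0$, regarded as an element of $\Omega^1(\mathbb{C}_q[S^2])\bar\otimes\mathcal{E}_{-n}$ via the injective multiplication map $\tau\bar\otimes\sigma\mapsto\tau\sigma\in\Omega^1(\mathbb{C}_q[SL_2])$. *)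

theory Defs
  imports
    Complex_Main
    "HOL-Library.Poly_Mapping"
    "HOL-Library.Product_Plus"
    "HOL-Algebra.Embedded_Algebras"
    "HOL-Algebra.Free_Abelian_Groups"
    "HOL-Algebra.Product_Groups"
    "HOL-Algebra.Algebraic_Closure_Type"
begin

section \<open>Free algebras\<close>

text \<open>Words form a monoid under concatenation (written additively, as the exponents of
  \<^typ>\<open>'a \<Rightarrow>\<^sub>0 'b\<close> are), so finitely supported functions on words with the convolution
  product are the free algebra on \<open>a, b, c, d\<close>. Likewise the finitely supported
  functions on pairs of words are the tensor square over \<open>\<complex>\<close> of that algebra, with
  \<open>(x \<otimes> y)(x' \<otimes> y') = xx' \<otimes> yy'\<close>.\<close>

instantiation list :: (type) monoid_add
begin

definition zero_list :: "'a list" where "zero_list = []"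

definition plus_list :: "'a list \<Rightarrow> 'a list \<Rightarrow> 'a list" where "plus_list = (@)"

instance by standard (simp_all add: zero_list_def plus_list_def)

end

datatype gen = GA | GB | GC | GD

type_synonym free = "gen list \<Rightarrow>\<^sub>0 complex"
type_synonym free2 = "(gen list \<times> gen list) \<Rightarrow>\<^sub>0 complex"

definition const :: "complex \<Rightarrow> ('w::zero \<Rightarrow>\<^sub>0 complex)" where
  "const z = Poly_Mapping.single 0 z"

definition word :: "'w \<Rightarrow> ('w \<Rightarrow>\<^sub>0 complex)" where
  "word w = Poly_Mapping.single w 1"

text \<open>The linear map with prescribed values on words.\<close>

definition lin_ext ::
    "('w \<Rightarrow> ('v::monoid_add \<Rightarrow>\<^sub>0 complex)) \<Rightarrow> ('w \<Rightarrow>\<^sub>0 complex) \<Rightarrow> ('v \<Rightarrow>\<^sub>0 complex)" where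
  "lin_ext \<phi> f = (\<Sum>w\<in>Poly_Mapping.keys f. const (Poly_Mapping.lookup f w) * \<phi> w)"

definition tens :: "free \<Rightarrow> free \<Rightarrow> free2" where
  "tens f g = (\<Sum>u\<in>Poly_Mapping.keys f. \<Sum>v\<in>Poly_Mapping.keys g.
     Poly_Mapping.single (u, v) (Poly_Mapping.lookup f u * Poly_Mapping.lookup g v))"

abbreviation gen :: "gen \<Rightarrow> free" where "gen x \<equiv> word [x]"

abbreviation "free_alg \<equiv> (ring_of_type_algebra :: free ring)"
abbreviation "free_alg2 \<equiv> (ring_of_type_algebra :: free2 ring)"


section \<open>The algebra of functions on quantum \<open>SL\<^sub>2\<close>\<close>

definition sl2_relators :: "complex \<Rightarrow> free set" where
  "sl2_relators q =
     {gen GB * gen GA - const q * (gen GA * gen GB),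
      gen GC * gen GA - const q * (gen GA * gen GC),
      gen GD * gen GB - const q * (gen GB * gen GD),
      gen GD * gen GC - const q * (gen GC * gen GD),
      gen GB * gen GC - gen GC * gen GB,
      gen GA * gen GD - (1 + const (inverse q) * (gen GB * gen GC)),
      gen GD * gen GA - (1 + const q * (gen GB * gen GC))}"

definition sl2_ideal :: "complex \<Rightarrow> free set" where
  "sl2_ideal q = genideal free_alg (sl2_relators q)"

definition SLq :: "complex \<Rightarrow> free set ring" where
  "SLq q = free_alg Quot sl2_ideal q"

definition cls :: "complex \<Rightarrow> free \<Rightarrow> free set" where
  "cls q f = sl2_ideal q +>\<^bsub>free_alg\<^esub> f"

text \<open>The map on \<^const>\<open>SLq\<close> induced by a linear map of the free algebra that preserves
  the ideal of relations.\<close>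

definition descend :: "complex \<Rightarrow> (free \<Rightarrow> free) \<Rightarrow> free set \<Rightarrow> free set" where
  "descend q h x = the_elem ((\<lambda>f. cls q (h f)) ` x)"

definition scalars :: "complex \<Rightarrow> free set set" where
  "scalars q = (\<lambda>z. cls q (const z)) ` UNIV"


subsection \<open>Grading\<close>

fun deg :: "gen \<Rightarrow> int" where
  "deg GA = 1" | "deg GB = -1" | "deg GC = 1" | "deg GD = -1"

definition word_deg :: "gen list \<Rightarrow> int" where
  "word_deg w = (\<Sum>x\<leftarrow>w. deg x)"

definition SLq_deg :: "complex \<Rightarrow> int \<Rightarrow> free set set" where
  "SLq_deg q n = {cls q f | f. \<forall>w\<in>Poly_Mapping.keys f. word_deg w = n}"

definition sphere :: "complex \<Rightarrow> free set set" where
  "sphere q = SLq_deg q 0"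


subsection \<open>Coproduct\<close>

fun coprod_gen :: "gen \<Rightarrow> free2" where
  "coprod_gen GA = tens (gen GA) (gen GA) + tens (gen GB) (gen GC)"
| "coprod_gen GB = tens (gen GA) (gen GB) + tens (gen GB) (gen GD)"
| "coprod_gen GC = tens (gen GC) (gen GA) + tens (gen GD) (gen GC)"
| "coprod_gen GD = tens (gen GC) (gen GB) + tens (gen GD) (gen GD)"

text \<open>The extension to an algebra homomorphism.\<close>

definition free_coprod :: "free \<Rightarrow> free2" where
  "free_coprod = lin_ext (\<lambda>w. \<Prod>x\<leftarrow>w. coprod_gen x)"

text \<open>\<open>(F/I) \<otimes> (F/I) = (F \<otimes> F)/(I \<otimes> F + F \<otimes> I)\<close> as algebras.\<close>

definition sl2_ideal2 :: "complex \<Rightarrow> free2 set" where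
  "sl2_ideal2 q = genideal free_alg2
     ({tens f g | f g. f \<in> sl2_ideal q} \<union> {tens f g | f g. g \<in> sl2_ideal q})"

definition SLq2 :: "complex \<Rightarrow> free2 set ring" where
  "SLq2 q = free_alg2 Quot sl2_ideal2 q"

definition cls2 :: "complex \<Rightarrow> free2 \<Rightarrow> free2 set" where
  "cls2 q f = sl2_ideal2 q +>\<^bsub>free_alg2\<^esub> f"

definition pure_tensor :: "complex \<Rightarrow> free set \<Rightarrow> free set \<Rightarrow> free2 set" where
  "pure_tensor q x y = the_elem ((\<lambda>(f, g). cls2 q (tens f g)) ` (x \<times> y))"

definition coproduct :: "complex \<Rightarrow> free set \<Rightarrow> free2 set" where
  "coproduct q x = the_elem ((\<lambda>f. cls2 q (free_coprod f)) ` x)"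

text \<open>\<open>\<complex>\<^sub>q[SL\<^sub>2] \<otimes> V\<close> as a subspace of \<^term>\<open>SLq2 q\<close>.\<close>

definition SLq_tensor :: "complex \<Rightarrow> free set set \<Rightarrow> free2 set set" where
  "SLq_tensor q V = generate (add_monoid (SLq2 q))
     {pure_tensor q x v | x v. x \<in> carrier (SLq q) \<and> v \<in> V}"

text \<open>A subcorepresentation of \<open>E\<close>, where \<open>E\<close> carries the left coaction obtained by
  restricting the coproduct. The library's \<^const>\<open>subalgebra\<close> only asks for a linear
  subspace.\<close>

definition left_subcomodule :: "complex \<Rightarrow> free set set \<Rightarrow> free set set \<Rightarrow> bool" where
  "left_subcomodule q E V \<longleftrightarrow>
     subalgebra (scalars q) V (SLq q) \<and> V \<subseteq> E \<and> coproduct q ` V \<subseteq> SLq_tensor q V"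


section \<open>The differential calculus\<close>

text \<open>A form \<open>x\<^sub>+ e\<^sup>+ + x\<^sub>- e\<^sup>- + x\<^sub>0 e\<^sup>0\<close> is its family of coefficients.\<close>

datatype idx = Ep | Em | E0

type_synonym form = "idx \<Rightarrow> free set"

definition Omega :: "complex \<Rightarrow> form monoid" where
  "Omega q = product_group UNIV (\<lambda>i. add_monoid (SLq q))"

definition basis_form :: "complex \<Rightarrow> idx \<Rightarrow> form" where
  "basis_form q j = (\<lambda>i. if i = j then \<one>\<^bsub>SLq q\<^esub> else \<zero>\<^bsub>SLq q\<^esub>)"

definition lmul :: "complex \<Rightarrow> free set \<Rightarrow> form \<Rightarrow> form" where
  "lmul q x \<omega> = (\<lambda>i. x \<otimes>\<^bsub>SLq q\<^esub> \<omega> i)"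

text \<open>\<open>e\<^sup>i x = q\<^sup>k\<^sup>|\<^sup>x\<^sup>| x e\<^sup>i\<close> with \<open>k = weight i\<close>, for homogeneous \<open>x\<close> of degree \<open>|x|\<close>;
  the linear extension of \<open>x \<mapsto> q\<^sup>k\<^sup>|\<^sup>x\<^sup>| x\<close> to inhomogeneous \<open>x\<close> is \<open>twist q k\<close>.\<close>

fun weight :: "idx \<Rightarrow> int" where
  "weight Ep = 1" | "weight Em = 1" | "weight E0 = 2"

definition free_twist :: "complex \<Rightarrow> int \<Rightarrow> free \<Rightarrow> free" where
  "free_twist q k = lin_ext (\<lambda>w. const (q powi (k * word_deg w)) * word w)"

definition twist :: "complex \<Rightarrow> int \<Rightarrow> free set \<Rightarrow> free set" where
  "twist q k = descend q (free_twist q k)"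

definition rmul :: "complex \<Rightarrow> form \<Rightarrow> free set \<Rightarrow> form" where
  "rmul q \<omega> x = (\<lambda>i. \<omega> i \<otimes>\<^bsub>SLq q\<^esub> twist q (weight i) x)"

text \<open>The differential is first defined as a derivation on the free algebra, by the values
  on the generators and the Leibniz rule \<open>d(xw) = (dx)w + x(dw)\<close>.\<close>

fun d_gen :: "complex \<Rightarrow> gen \<Rightarrow> idx \<Rightarrow> free" where
  "d_gen q GA = (\<lambda>i. case i of Ep \<Rightarrow> const q * gen GB | Em \<Rightarrow> 0 | E0 \<Rightarrow> gen GA)"
| "d_gen q GB = (\<lambda>i. case i of Ep \<Rightarrow> 0 | Em \<Rightarrow> gen GA | E0 \<Rightarrow> - const (inverse (q ^ 2)) * gen GB)"
| "d_gen q GC = (\<lambda>i. case i of Ep \<Rightarrow> const q * gen GD | Em \<Rightarrow> 0 | E0 \<Rightarrow> gen GC)"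
| "d_gen q GD = (\<lambda>i. case i of Ep \<Rightarrow> 0 | Em \<Rightarrow> gen GC | E0 \<Rightarrow> - const (inverse (q ^ 2)) * gen GD)"

fun d_word :: "complex \<Rightarrow> gen list \<Rightarrow> idx \<Rightarrow> free" where
  "d_word q [] = (\<lambda>i. 0)"
| "d_word q (x # w) =
     (\<lambda>i. d_gen q x i * free_twist q (weight i) (word w) + gen x * d_word q w i)"

definition free_d :: "complex \<Rightarrow> idx \<Rightarrow> free \<Rightarrow> free" where
  "free_d q i = lin_ext (\<lambda>w. d_word q w i)"

definition differential :: "complex \<Rightarrow> free set \<Rightarrow> form" where
  "differential q x = (\<lambda>i. descend q (free_d q i) x)"

definition Omega10 :: "complex \<Rightarrow> form set" where
  "Omega10 q = {lmul q x (basis_form q Ep) | x. x \<in> SLq_deg q (-2)}"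


section \<open>Tensor products over a noncommutative ring\<close>

text \<open>\<open>M \<otimes>\<^sub>B N\<close> for a right \<open>B\<close>-module \<open>M\<close> and a left \<open>B\<close>-module \<open>N\<close>, as the free abelian group
  on \<open>M \<times> N\<close> modulo the balanced bilinearity relations. The group operations of \<open>M\<close> and
  \<open>N\<close> are written multiplicatively.\<close>

definition tensor_relators ::
    "('m, 'x) monoid_scheme \<Rightarrow> ('m \<Rightarrow> 'b \<Rightarrow> 'm) \<Rightarrow> 'b set \<Rightarrow> ('b \<Rightarrow> 'n \<Rightarrow> 'n) \<Rightarrow>
     ('n, 'y) monoid_scheme \<Rightarrow> (('m \<times> 'n) \<Rightarrow>\<^sub>0 int) set" where
  "tensor_relators M ract B lact N =
     {frag_of (x \<otimes>\<^bsub>M\<^esub> x', y) - frag_of (x, y) - frag_of (x', y) | x x' y.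
        x \<in> carrier M \<and> x' \<in> carrier M \<and> y \<in> carrier N}
   \<union> {frag_of (x, y \<otimes>\<^bsub>N\<^esub> y') - frag_of (x, y) - frag_of (x, y') | x y y'.
        x \<in> carrier M \<and> y \<in> carrier N \<and> y' \<in> carrier N}
   \<union> {frag_of (ract x b, y) - frag_of (x, lact b y) | x b y.
        x \<in> carrier M \<and> b \<in> B \<and> y \<in> carrier N}"

definition tensor_group ::
    "('m, 'x) monoid_scheme \<Rightarrow> ('m \<Rightarrow> 'b \<Rightarrow> 'm) \<Rightarrow> 'b set \<Rightarrow> ('b \<Rightarrow> 'n \<Rightarrow> 'n) \<Rightarrow>
     ('n, 'y) monoid_scheme \<Rightarrow> (('m \<times> 'n) \<Rightarrow>\<^sub>0 int) set monoid" where
  "tensor_group M ract B lact N =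
     (let F = free_Abelian_group (carrier M \<times> carrier N)
      in F Mod generate F (tensor_relators M ract B lact N))"


section \<open>The monopole connection\<close>

text \<open>\<open>[n; p] = (1 - p\<^sup>n)/(1 - p)\<close>, with its usual value \<open>n\<close> (the limit) at \<open>p = 1\<close>.\<close>

definition qint :: "nat \<Rightarrow> complex \<Rightarrow> complex" where
  "qint n p = (if p = 1 then of_nat n else (1 - p ^ n) / (1 - p))"

text \<open>The sections of the bundle of charge \<open>-n\<close>.\<close>

definition monopole :: "complex \<Rightarrow> nat \<Rightarrow> free set set" where
  "monopole q n = SLq_deg q (int n)"

definition monopole_D :: "complex \<Rightarrow> nat \<Rightarrow> free set \<Rightarrow> form" where
  "monopole_D q n \<sigma> = (\<lambda>i. differential q \<sigma> i \<ominus>\<^bsub>SLq q\<^esub>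
     lmul q (cls q (const (qint n (q ^ 2))) \<otimes>\<^bsub>SLq q\<^esub> \<sigma>) (basis_form q E0) i)"

text \<open>\<open>\<Omega>\<^sup>1\<^sup>,\<^sup>0 \<otimes> \<E>\<^sub>-\<^sub>n\<close> over the quantum sphere.\<close>

definition hol_tensor :: "complex \<Rightarrow> nat \<Rightarrow> ((form \<times> free set) \<Rightarrow>\<^sub>0 int) set monoid" where
  "hol_tensor q n =
     tensor_group ((Omega q)\<lparr>carrier := Omega10 q\<rparr>) (rmul q) (sphere q)
       (\<lambda>x y. x \<otimes>\<^bsub>SLq q\<^esub> y) ((add_monoid (SLq q))\<lparr>carrier := monopole q n\<rparr>)"

text \<open>The multiplication map \<open>\<tau> \<otimes> \<sigma> \<mapsto> \<tau>\<sigma>\<close>, into all one-forms on quantum \<open>SL\<^sub>2\<close>.\<close>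

definition tensor_mult :: "complex \<Rightarrow> ((form \<times> free set) \<Rightarrow>\<^sub>0 int) set \<Rightarrow> form" where
  "tensor_mult q t =
     the_elem ((\<lambda>f. finprod (Omega q)
       (\<lambda>p. rmul q (fst p) (snd p) [^]\<^bsub>Omega q\<^esub> Poly_Mapping.lookup f p)
       (Poly_Mapping.keys f)) ` t)"

definition hol_sections :: "complex \<Rightarrow> nat \<Rightarrow> free set set" where
  "hol_sections q n = {\<sigma> \<in> monopole q n.
     \<exists>t \<in> carrier (hol_tensor q n). tensor_mult q t = monopole_D q n \<sigma>}"

text \<open>The span of the \<open>c\<^sup>s a\<^sup>t\<close> with \<open>s + t = n\<close>.\<close>

definition standard_corep :: "complex \<Rightarrow> nat \<Rightarrow> free set set" where
  "standard_corep q n = ring.Span (SLq q) (scalars q)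
     (map (\<lambda>s. cls q (gen GC) [^]\<^bsub>SLq q\<^esub> s \<otimes>\<^bsub>SLq q\<^esub> cls q (gen GA) [^]\<^bsub>SLq q\<^esub> (n - s)) [0..<Suc n])"

end

theory Submission
  imports Defs
begin

text \<open>On a word \<open>w\<close> of length \<open>n\<close> in \<open>a\<close> and \<open>c\<close>, the Leibniz rule gives \<open>dw\<close> no \<open>e\<^sup>-\<close> component and
  the \<open>e\<^sup>0\<close> component \<open>[n; q\<^sup>2] w\<close>, already in the free algebra; so \<open>Dw\<close> is a multiple of \<open>e\<^sup>+\<close> whose
  coefficient has degree \<open>n - 2\<close>. Such a form lies in the image of \<open>\<Omega>\<^sup>1\<^sup>,\<^sup>0 \<otimes> \<E>\<^sub>-\<^sub>n\<close> because \<open>1\<close> is a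
  sum of products of elements of degrees \<open>-2\<close> and \<open>2\<close>. The words of length \<open>n\<close> in \<open>a\<close> and \<open>c\<close> span
  the \<open>c\<^sup>s a\<^sup>t\<close> and the second tensor factors of their coproducts are again such words. The
  \<open>c\<^sup>s a\<^sup>t\<close> are independent since a representation on Laurent polynomials sends the constant \<open>1\<close> to
  nonzero multiples of distinct powers.\<close>

section \<open>Linear maps on monoid algebras\<close>

lemma const_0 [simp]: "const 0 = 0"
  and const_1 [simp]: "const 1 = 1"
  by (simp_all add: const_def)

lemma const_add: "const (x + y) = const x + const y"
  by (simp add: const_def single_add)

lemma const_uminus: "const (- x) = - const x"
  by (simp add: const_def single_uminus)

lemma const_mult: "const (x * y) = const x * (const y :: 'w::monoid_add \<Rightarrow>\<^sub>0 complex)"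
  by (simp add: const_def mult_single)

lemma const_times_single:
  "const z * Poly_Mapping.single (w::'w::monoid_add) x = Poly_Mapping.single w (z * x)"
  by (simp add: const_def mult_single)

lemma single_times_const:
  "Poly_Mapping.single (w::'w::monoid_add) x * const z = Poly_Mapping.single w (x * z)"
  by (simp add: const_def mult_single)

lemma poly_mapping_sum_single:
  "(f::'w \<Rightarrow>\<^sub>0 complex) = (\<Sum>w\<in>Poly_Mapping.keys f. Poly_Mapping.single w (Poly_Mapping.lookup f w))"
proof (rule poly_mapping_eqI)
  fix k
  have "Poly_Mapping.lookup (\<Sum>w\<in>Poly_Mapping.keys f. Poly_Mapping.single w (Poly_Mapping.lookup f w)) k
    = (\<Sum>w\<in>Poly_Mapping.keys f. if w = k then Poly_Mapping.lookup f w else 0)"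
    by (auto simp: lookup_sum lookup_single when_def intro!: sum.cong)
  also have "\<dots> = Poly_Mapping.lookup f k"
    by (auto simp: sum.delta' in_keys_iff)
  finally show "Poly_Mapping.lookup f k = Poly_Mapping.lookup
      (\<Sum>w\<in>Poly_Mapping.keys f. Poly_Mapping.single w (Poly_Mapping.lookup f w)) k"
    by simp
qed

lemma sum_closure:
  assumes "P 0" "\<And>f g. P f \<Longrightarrow> P g \<Longrightarrow> P (f + g)" "\<And>x. x \<in> A \<Longrightarrow> P (h x)"
  shows "P (\<Sum>x\<in>A. h x)"
  using assms(3) by (induction A rule: infinite_finite_induct) (auto intro: assms(1,2))

text \<open>A finitely supported function is the sum of its monomials, so an additive predicate need
  only be checked on scalar multiples of the allowed words. Linear identities below are reduced to
  single words in this way.\<close>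

lemma supported_induct [consumes 1, case_names zero add single]:
  fixes f :: "'w \<Rightarrow>\<^sub>0 complex"
  assumes "Poly_Mapping.keys f \<subseteq> A" "P 0" "\<And>f g. P f \<Longrightarrow> P g \<Longrightarrow> P (f + g)"
    "\<And>w z. w \<in> A \<Longrightarrow> P (Poly_Mapping.single w z)"
  shows "P f"
  by (subst poly_mapping_sum_single, rule sum_closure) (use assms in auto)

lemmas pm_induct = supported_induct[where A = UNIV, simplified, case_names zero add single]

text \<open>Scalars sit on the neutral element of the exponent monoid, hence are central although
  words do not commute.\<close>

lemma const_commute: "const z * f = f * const z"
  by (induction f rule: pm_induct)
    (simp_all add: const_times_single single_times_const algebra_simps)

lemma const_left_commute: "f * (const z * g) = const z * (f * g)"
  by (simp add: const_commute[of z f] flip: mult.assoc)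

text \<open>Elements outside the support contribute \<open>const 0\<close>. Additivity needs this
  common index set, since the support of a sum can be smaller than the union.\<close>

lemma lin_ext_superset:
  assumes "finite A" "Poly_Mapping.keys f \<subseteq> A"
  shows "lin_ext \<phi> f = (\<Sum>w\<in>A. const (Poly_Mapping.lookup f w) * \<phi> w)"
  unfolding lin_ext_def
  by (rule sum.mono_neutral_left) (use assms in \<open>auto simp: in_keys_iff\<close>)

lemma lin_ext_0 [simp]: "lin_ext \<phi> 0 = 0"
  by (simp add: lin_ext_def)

lemma lin_ext_add: "lin_ext \<phi> (f + g) = lin_ext \<phi> f + lin_ext \<phi> g"
proof -
  let ?A = "Poly_Mapping.keys f \<union> Poly_Mapping.keys g"
  have "Poly_Mapping.keys (f + g) \<subseteq> ?A"
    by (rule keys_add)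
  then show ?thesis
    by (simp add: lin_ext_superset[of ?A] lookup_add const_add distrib_right sum.distrib)
qed

lemma lin_ext_single [simp]: "lin_ext \<phi> (Poly_Mapping.single w z) = const z * \<phi> w"
  by (simp add: lin_ext_superset[of "{w}"])

lemma lin_ext_uminus: "lin_ext \<phi> (- f) = - lin_ext \<phi> f"
  using lin_ext_add[of \<phi> f "- f"] by (simp add: eq_neg_iff_add_eq_0 add.commute)

lemma lin_ext_diff: "lin_ext \<phi> (f - g) = lin_ext \<phi> f - lin_ext \<phi> g"
  using lin_ext_add[of \<phi> f "- g"] by (simp add: lin_ext_uminus)

lemma lin_ext_const:
  "lin_ext \<phi> (const z * f) = const z * lin_ext \<phi> (f :: 'w::monoid_add \<Rightarrow>\<^sub>0 complex)"
  by (induction f rule: pm_induct)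
    (simp_all add: const_times_single lin_ext_add distrib_left const_mult mult.assoc)

lemma word_single: "const z * word w = Poly_Mapping.single (w::'w::monoid_add) z"
  by (simp add: word_def const_times_single)

lemma word_mult: "word u * word v = (word (u + v) :: 'w::monoid_add \<Rightarrow>\<^sub>0 complex)"
  by (simp add: word_def mult_single)

lemma word_0: "(word 0 :: 'w::monoid_add \<Rightarrow>\<^sub>0 complex) = 1"
  by (simp add: word_def)

lemma lin_ext_word [simp]: "lin_ext \<phi> (word w) = \<phi> w"
  by (simp add: word_def)

section \<open>Twists and the twisted derivation on the free algebra\<close>

lemma word_deg_append: "word_deg (u @ v) = word_deg u + word_deg v"
  by (simp add: word_deg_def)

text \<open>Degrees add under concatenation, and \<open>q powi\<close> turns sums into products for
  nonzero \<open>q\<close>.\<close>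

lemma free_twist_mult:
  assumes "q \<noteq> 0"
  shows "free_twist q k (f * g) = free_twist q k f * free_twist q k g"
proof (induction f rule: pm_induct)
  case (single u x)
  show ?case
  proof (induction g rule: pm_induct)
    case (single v y)
    show ?case
      by (simp add: free_twist_def mult_single word_single const_times_single plus_list_def
          word_deg_append distrib_left power_int_add assms mult_ac)
  qed (simp_all add: free_twist_def lin_ext_add distrib_left)
qed (simp_all add: free_twist_def lin_ext_add distrib_right)

lemma free_twist_add: "free_twist q k (f + g) = free_twist q k f + free_twist q k g"
  by (simp add: free_twist_def lin_ext_add)

lemma free_twist_0 [simp]: "free_twist q k 0 = 0"
  by (simp add: free_twist_def)

text \<open>The recursion of \<open>d_word\<close> splits off a single letter. Splitting anywhere
  follows because the twist of the remaining word is multiplicative.\<close>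

lemma d_word_append:
  assumes "q \<noteq> 0"
  shows "d_word q (u @ v) i = d_word q u i * free_twist q (weight i) (word v) + word u * d_word q v i"
proof (induction u)
  case Nil
  show ?case
    using word_0[where 'w = "gen list"] by (simp add: zero_list_def)
next
  case (Cons x u)
  have "word (u @ v) = word u * word v" "word (x # u) = word [x] * word u"
    by (simp_all add: word_mult plus_list_def)
  then show ?case
    using Cons by (simp add: free_twist_mult[OF assms] algebra_simps)
qed

lemma free_d_0 [simp]: "free_d q i 0 = 0"
  and free_d_add: "free_d q i (f + g) = free_d q i f + free_d q i g"
  and free_d_diff: "free_d q i (f - g) = free_d q i f - free_d q i g"
  by (simp_all add: free_d_def lin_ext_add lin_ext_diff)

text \<open>This is the Leibniz rule read off on left coefficients: in \<open>(df) g\<close> the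
  basis form \<open>e^i\<close> has to pass \<open>g\<close>, which twists \<open>g\<close> by the
  weight of \<open>i\<close>.\<close>

lemma free_d_mult:
  assumes "q \<noteq> 0"
  shows "free_d q i (f * g) = free_d q i f * free_twist q (weight i) g + f * free_d q i g"
proof (induction f rule: pm_induct)
  case (single u x)
  show ?case
  proof (induction g rule: pm_induct)
    case (single v y)
    have "free_d q i (Poly_Mapping.single u x * Poly_Mapping.single v y)
      = const x * const y * (d_word q u i * free_twist q (weight i) (word v) + word u * d_word q v i)"
      by (simp add: free_d_def mult_single plus_list_def d_word_append[OF assms] const_mult)
    also have "\<dots> = (const x * d_word q u i) * (const y * free_twist q (weight i) (word v))
        + (const x * word u) * (const y * d_word q v i)"
      using const_commute[of y "d_word q u i"] const_commute[of y "word u"]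
      by (simp add: distrib_left mult.assoc) (simp flip: mult.assoc)
    also have "const y * free_twist q (weight i) (word v) = free_twist q (weight i) (Poly_Mapping.single v y)"
      by (simp add: free_twist_def)
    finally show ?case
      by (simp add: free_d_def word_single)
  qed (simp_all add: free_d_add free_twist_add algebra_simps)
qed (simp_all add: free_d_add algebra_simps)

section \<open>Quotients of rings on a type\<close>

abbreviation TA :: "'a::ring_1 ring" where "TA \<equiv> ring_of_type_algebra"

lemma TA_simps [simp]:
  "carrier (TA :: 'a::ring_1 ring) = UNIV"
  "x \<otimes>\<^bsub>TA\<^esub> y = (x * y :: 'a)"
  "\<one>\<^bsub>TA\<^esub> = (1 :: 'a)"
  "\<zero>\<^bsub>TA\<^esub> = (0 :: 'a)"
  "x \<oplus>\<^bsub>TA\<^esub> y = (x + y :: 'a)"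
  by (simp_all add: ring_of_type_algebra_def)

lemma ring_TA: "ring (TA :: 'a::ring_1 ring)"
proof -
  have "\<exists>y. x + y = 0" for x :: 'a
    by (metis add.right_inverse)
  then show ?thesis
    unfolding ring_of_type_algebra_def
    by unfold_locales (auto simp: algebra_simps Units_def intro: exI[of _ "- _"])
qed

lemma a_inv_TA [simp]: "\<ominus>\<^bsub>TA\<^esub> x = (- x :: 'a::ring_1)"
  by (rule abelian_group.minus_equality[OF ring.is_abelian_group[OF ring_TA]]) simp_all

lemma ideal_TA_I:
  fixes I :: "'a::ring_1 set"
  assumes "0 \<in> I" "\<And>x y. x \<in> I \<Longrightarrow> y \<in> I \<Longrightarrow> x + y \<in> I"
    "\<And>x y. x \<in> I \<Longrightarrow> x * y \<in> I" "\<And>x y. x \<in> I \<Longrightarrow> y * x \<in> I"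
  shows "ideal I TA"
proof (rule idealI[OF ring_TA])
  interpret ring "TA :: 'a ring"
    by (rule ring_TA)
  have "- x \<in> I" if "x \<in> I" for x
    using assms(4)[OF that, of "- 1"] by simp
  then show "subgroup I (add_monoid TA)"
    using assms(1,2) by (intro add.subgroupI) (auto simp: a_inv_def[symmetric])
qed (use assms in auto)

text \<open>Both \<open>SLq\<close> and \<open>SLq2\<close> are quotients of a ring carried by a
  whole type. The locale provides their coset arithmetic once and is interpreted for both
  ideals.\<close>

locale type_ideal =
  fixes I :: "'a::ring_1 set"
  assumes is_ideal: "ideal I TA"
begin

lemma mem_zero [simp]: "0 \<in> I"
  and mem_add: "x \<in> I \<Longrightarrow> y \<in> I \<Longrightarrow> x + y \<in> I"
  and mem_lmul: "x \<in> I \<Longrightarrow> y * x \<in> I"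
  and mem_rmul: "x \<in> I \<Longrightarrow> x * y \<in> I"
  using additive_subgroup.zero_closed[OF ideal.axioms(1)[OF is_ideal]]
    additive_subgroup.a_closed[OF ideal.axioms(1)[OF is_ideal]]
    ideal.I_r_closed[OF is_ideal] ideal.I_l_closed[OF is_ideal] by auto

lemma mem_uminus: "x \<in> I \<Longrightarrow> - x \<in> I"
  using mem_lmul[of x "- 1"] by simp

lemma mem_diff: "x \<in> I \<Longrightarrow> y \<in> I \<Longrightarrow> x - y \<in> I"
  using mem_add[of x "- y"] mem_uminus[of y] by simp

lemma ideal_abelian: "abelian_subgroup I TA"
  by (intro abelian_subgroupI3 ideal.axioms(1)[OF is_ideal] ring.is_abelian_group[OF ring_TA])

lemma coset_eq_iff: "I +>\<^bsub>TA\<^esub> x = I +>\<^bsub>TA\<^esub> y \<longleftrightarrow> x - y \<in> I"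
  using ring.quotient_eq_iff_same_a_r_cos[OF ring_TA is_ideal, of x y] by (simp add: a_minus_def)

lemma coset_unfold: "I +>\<^bsub>TA\<^esub> x = {i + x | i. i \<in> I}"
  by (auto simp: a_r_coset_def' )

lemma coset_zero: "I +>\<^bsub>TA\<^esub> 0 = I"
  by (simp add: coset_unfold)

lemma carrier_quot: "carrier (TA Quot I) = range ((+>\<^bsub>TA\<^esub>) I)"
  unfolding FactRing_def A_RCOSETS_def' a_r_coset_def' by auto

lemma quot_mult: "(I +>\<^bsub>TA\<^esub> x) \<otimes>\<^bsub>TA Quot I\<^esub> (I +>\<^bsub>TA\<^esub> y) = I +>\<^bsub>TA\<^esub> (x * y)"
  using ideal.rcoset_mult_add[OF is_ideal, of x y] by (simp add: FactRing_def)

lemma quot_add: "(I +>\<^bsub>TA\<^esub> x) \<oplus>\<^bsub>TA Quot I\<^esub> (I +>\<^bsub>TA\<^esub> y) = I +>\<^bsub>TA\<^esub> (x + y)"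
  using abelian_subgroup.a_rcos_sum[OF ideal_abelian, of x y] by (simp add: FactRing_def)

lemma quot_one: "\<one>\<^bsub>TA Quot I\<^esub> = I +>\<^bsub>TA\<^esub> 1"
  by (simp add: FactRing_def)

lemma quot_zero: "\<zero>\<^bsub>TA Quot I\<^esub> = I +>\<^bsub>TA\<^esub> 0"
  by (simp add: FactRing_def coset_zero)

lemma quot_uminus: "\<ominus>\<^bsub>TA Quot I\<^esub> (I +>\<^bsub>TA\<^esub> x) = I +>\<^bsub>TA\<^esub> (- x)"
proof -
  interpret Q: ring "TA Quot I"
    by (rule ideal.quotient_is_ring[OF is_ideal])
  show ?thesis
    by (rule Q.minus_equality) (auto simp: quot_add quot_zero carrier_quot)
qed

text \<open>\<open>descend\<close> and \<open>coproduct\<close> apply a map to all representatives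
  of a coset and extract the only value. Invariance under the ideal is what makes that value
  unique.\<close>

lemma the_elem_coset:
  assumes "\<And>i. i \<in> I \<Longrightarrow> h (i + x) = h x"
  shows "the_elem (h ` (I +>\<^bsub>TA\<^esub> x)) = h x"
proof -
  have "h ` (I +>\<^bsub>TA\<^esub> x) = {h x}"
    using assms by (force simp: coset_unfold intro: exI[of _ 0])
  then show ?thesis
    by simp
qed

end

lemma type_ideal_genideal: "type_ideal (genideal TA (S :: 'a::ring_1 set))"
  by (rule type_ideal.intro) (simp add: ring.genideal_ideal[OF ring_TA])

lemma genideal_TA_incl: "x \<in> S \<Longrightarrow> x \<in> genideal TA (S :: 'a::ring_1 set)"
  using ring.genideal_self[OF ring_TA, of S] by auto

lemma genideal_TA_subset:
  fixes S :: "'a::ring_1 set"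
  assumes "S \<subseteq> J" "0 \<in> J" "\<And>x y. x \<in> J \<Longrightarrow> y \<in> J \<Longrightarrow> x + y \<in> J"
    "\<And>x y. x \<in> J \<Longrightarrow> x * y \<in> J" "\<And>x y. x \<in> J \<Longrightarrow> y * x \<in> J"
  shows "genideal TA S \<subseteq> J"
  by (rule ring.genideal_minimal[OF ring_TA]) (use assms in \<open>auto intro!: ideal_TA_I\<close>)

section \<open>Relations and differential of quantum \<open>SL\<^sub>2\<close>\<close>

text \<open>The relators get names so that their images under the differential and the coproduct can
  be written as explicit combinations of relators.\<close>

definition rel_ba :: "complex \<Rightarrow> free" where
  "rel_ba q = gen GB * gen GA - const q * (gen GA * gen GB)"
definition rel_ca :: "complex \<Rightarrow> free" where
  "rel_ca q = gen GC * gen GA - const q * (gen GA * gen GC)"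
definition rel_db :: "complex \<Rightarrow> free" where
  "rel_db q = gen GD * gen GB - const q * (gen GB * gen GD)"
definition rel_dc :: "complex \<Rightarrow> free" where
  "rel_dc q = gen GD * gen GC - const q * (gen GC * gen GD)"
definition rel_bc :: free where
  "rel_bc = gen GB * gen GC - gen GC * gen GB"
definition rel_ad :: "complex \<Rightarrow> free" where
  "rel_ad q = gen GA * gen GD - (1 + const (inverse q) * (gen GB * gen GC))"
definition rel_da :: "complex \<Rightarrow> free" where
  "rel_da q = gen GD * gen GA - (1 + const q * (gen GB * gen GC))"

lemmas rel_defs = rel_ba_def rel_ca_def rel_db_def rel_dc_def rel_bc_def rel_ad_def rel_da_def

lemma sl2_relators_eq:
  "sl2_relators q = {rel_ba q, rel_ca q, rel_db q, rel_dc q, rel_bc, rel_ad q, rel_da q}"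
  by (simp add: sl2_relators_def rel_defs)

interpretation sl2: type_ideal "sl2_ideal q" for q
  unfolding sl2_ideal_def by (rule type_ideal_genideal)

lemma sl2_relator_mem:
  "rel_ba q \<in> sl2_ideal q" "rel_ca q \<in> sl2_ideal q" "rel_db q \<in> sl2_ideal q"
  "rel_dc q \<in> sl2_ideal q" "rel_bc \<in> sl2_ideal q" "rel_ad q \<in> sl2_ideal q" "rel_da q \<in> sl2_ideal q"
  unfolding sl2_ideal_def by (auto intro!: genideal_TA_incl simp: sl2_relators_eq)

text \<open>To show that a map respects the relations, \<open>J\<close> is taken as the set of
  elements with admissible image; only the seven relators then need a computation.\<close>

lemma sl2_ideal_subset:
  assumes "\<And>r. r \<in> sl2_relators q \<Longrightarrow> r \<in> J" "0 \<in> J" "\<And>x y. x \<in> J \<Longrightarrow> y \<in> J \<Longrightarrow> x + y \<in> J"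
    "\<And>x y. x \<in> J \<Longrightarrow> x * y \<in> J" "\<And>x y. x \<in> J \<Longrightarrow> y * x \<in> J"
  shows "sl2_ideal q \<subseteq> J"
  unfolding sl2_ideal_def by (rule genideal_TA_subset) (use assms in auto)

lemma cls_eq_iff: "cls q f = cls q g \<longleftrightarrow> f - g \<in> sl2_ideal q"
  by (simp add: cls_def sl2.coset_eq_iff)

lemma ring_SLq: "ring (SLq q)"
  unfolding SLq_def by (rule ideal.quotient_is_ring[OF sl2.is_ideal])

lemma SLq_simps [simp]:
  "cls q f \<in> carrier (SLq q)"
  "cls q f \<otimes>\<^bsub>SLq q\<^esub> cls q g = cls q (f * g)"
  "cls q f \<oplus>\<^bsub>SLq q\<^esub> cls q g = cls q (f + g)"
  "\<ominus>\<^bsub>SLq q\<^esub> cls q f = cls q (- f)"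
  "cls q f \<ominus>\<^bsub>SLq q\<^esub> cls q g = cls q (f - g)"
  by (simp_all add: SLq_def cls_def sl2.carrier_quot sl2.quot_mult sl2.quot_add sl2.quot_uminus
      a_minus_def)

lemma SLq_one: "\<one>\<^bsub>SLq q\<^esub> = cls q 1"
  and SLq_zero: "\<zero>\<^bsub>SLq q\<^esub> = cls q 0"
  by (simp_all add: SLq_def cls_def sl2.quot_one sl2.quot_zero)

lemma SLq_nat_pow: "cls q f [^]\<^bsub>SLq q\<^esub> (n::nat) = cls q (f ^ n)"
proof -
  interpret ring "SLq q"
    by (rule ring_SLq)
  show ?thesis
    by (induction n) (simp_all add: SLq_one power_commutes)
qed

lemma descend_cls:
  assumes "\<And>f. f \<in> sl2_ideal q \<Longrightarrow> h f \<in> sl2_ideal q" "\<And>f g. h (f + g) = h f + h g"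
  shows "descend q h (cls q f) = cls q (h f)"
  unfolding descend_def cls_def[of q f]
  by (rule sl2.the_elem_coset) (use assms in \<open>auto simp: cls_eq_iff\<close>)

lemma free_one_single: "(1 :: free) = Poly_Mapping.single [] 1"
  by (simp add: zero_list_def flip: single_one)

lemmas monomial_simps = word_def const_def mult_single plus_list_def zero_list_def

lemma lookup_simps:
  "Poly_Mapping.lookup (f - g) k = Poly_Mapping.lookup f k - Poly_Mapping.lookup g k"
  "Poly_Mapping.lookup (f + g) k = Poly_Mapping.lookup f k + Poly_Mapping.lookup g k"
  "Poly_Mapping.lookup (- f) k = - Poly_Mapping.lookup f (k::'k)"
  "Poly_Mapping.lookup (Poly_Mapping.single w z) k = (if w = k then z else 0)"
  for f g :: "'k \<Rightarrow>\<^sub>0 complex"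
  by (simp_all add: lookup_minus lookup_add lookup_single when_def)

lemma free_twist_single: "free_twist q k (Poly_Mapping.single w z)
   = Poly_Mapping.single w (z * q powi (k * word_deg w))"
  by (simp add: free_twist_def word_single const_times_single)

lemma free_twist_const [simp]: "free_twist q k (const z) = const z"
  by (simp add: const_def free_twist_single word_deg_def zero_list_def)

lemma free_twist_1 [simp]: "free_twist q k 1 = 1"
  using free_twist_const[of q k 1] by simp

lemma free_twist_gen: "free_twist q k (gen x) = const (q powi (k * deg x)) * gen x"
  by (simp add: word_def free_twist_single const_times_single word_deg_def)

lemma free_d_gen [simp]: "free_d q i (gen x) = d_gen q x i"
proof -
  have "free_twist q (weight i) (word []) = 1"
    by (simp flip: free_one_single add: word_def)
  then show ?thesis
    by (simp add: free_d_def)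
qed

lemma free_d_const [simp]: "free_d q i (const z) = 0"
  by (simp add: free_d_def const_def zero_list_def)

lemma free_d_1 [simp]: "free_d q i 1 = 0"
  using free_d_const[of q i 1] by simp

section \<open>The grading on representatives in the free algebra\<close>

definition homog :: "int \<Rightarrow> free \<Rightarrow> bool" where
  "homog m f \<longleftrightarrow> (\<forall>w\<in>Poly_Mapping.keys f. word_deg w = m)"

lemma homog_0 [simp]: "homog m 0"
  by (simp add: homog_def)

lemma homog_add: "homog m f \<Longrightarrow> homog m g \<Longrightarrow> homog m (f + g)"
  using keys_add[of f g] by (auto simp: homog_def)

lemma homog_uminus: "homog m f \<Longrightarrow> homog m (- f)"
  by (simp add: homog_def)

lemma homog_diff: "homog m f \<Longrightarrow> homog m g \<Longrightarrow> homog m (f - g)"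
  using homog_add[of m f "- g"] homog_uminus[of m g] by simp

lemma homog_mult: "homog m f \<Longrightarrow> homog k g \<Longrightarrow> homog (m + k) (f * g)"
  using keys_mult[of f g] by (fastforce simp: homog_def plus_list_def word_deg_append)

lemma homog_const: "homog 0 (const z)"
  by (auto simp: homog_def const_def word_deg_def zero_list_def split: if_splits)

lemma homog_1: "homog 0 1"
  using homog_const[of 1] by simp

lemma homog_const_mult: "homog m f \<Longrightarrow> homog m (const z * f)"
  using homog_mult[OF homog_const] by fastforce

lemma homog_word: "homog (word_deg w) (word w)"
  by (simp add: homog_def word_def)

lemma homog_gen: "homog (deg x) (gen x)"
  using homog_word[of "[x]"] by (simp add: word_deg_def)

lemma homog_gen2: "deg x + deg y = m \<Longrightarrow> homog m (gen x * gen y)"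
  using homog_mult[OF homog_gen homog_gen] by blast

lemma free_twist_homog:
  assumes "homog m f"
  shows "free_twist q k f = const (q powi (k * m)) * f"
proof -
  have "Poly_Mapping.keys f \<subseteq> {w. word_deg w = m}"
    using assms by (auto simp: homog_def)
  then show ?thesis
    by (induction rule: supported_induct)
      (simp_all add: free_twist_add distrib_left free_twist_single const_times_single mult.commute)
qed

lemma homog_relators:
  "homog 0 (rel_ba q)" "homog 2 (rel_ca q)" "homog (- 2) (rel_db q)" "homog 0 (rel_dc q)"
  "homog 0 rel_bc" "homog 0 (rel_ad q)" "homog 0 (rel_da q)"
  unfolding rel_defs
  by (intro homog_diff homog_add homog_const_mult homog_1 homog_gen2; simp)+

section \<open>Descent of the twist and of the differential\<close>

lemma free_twist_relator:
  assumes "r \<in> sl2_relators q"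
  shows "\<exists>z. free_twist q k r = const z * r"
  using assms homog_relators free_twist_homog unfolding sl2_relators_eq by blast

text \<open>Relators are homogeneous, so the twist only rescales them, and being multiplicative it
  preserves the ideal that they generate.\<close>

lemma free_twist_ideal:
  assumes "q \<noteq> 0" "f \<in> sl2_ideal q"
  shows "free_twist q k f \<in> sl2_ideal q"
proof -
  have "sl2_ideal q \<subseteq> {f. free_twist q k f \<in> sl2_ideal q}"
  proof (rule sl2_ideal_subset)
    show "r \<in> {f. free_twist q k f \<in> sl2_ideal q}" if r: "r \<in> sl2_relators q" for r
    proof -
      obtain z where "free_twist q k r = const z * r"
        using free_twist_relator[OF r] by blast
      moreover have "r \<in> sl2_ideal q"
        using r sl2_relator_mem by (auto simp: sl2_relators_eq)
      ultimately show ?thesis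
        by (simp add: sl2.mem_lmul)
    qed
  qed (auto simp: free_twist_mult[OF assms(1)] free_twist_add sl2.mem_add sl2.mem_lmul sl2.mem_rmul)
  with assms(2) show ?thesis by auto
qed

text \<open>The consistency check of the calculus: already in the free algebra, every component of
  the derivative of a relator is an explicit combination of relators.\<close>

lemma free_d_relators:
  assumes "q \<noteq> 0"
  shows "free_d q Ep (rel_ba q) = 0" "free_d q Em (rel_ba q) = 0" "free_d q E0 (rel_ba q) = 0"
    "free_d q Ep (rel_ca q) = const (q\<^sup>2) * rel_da q - const q * rel_bc - const (q\<^sup>2) * rel_ad q"
    "free_d q Em (rel_ca q) = 0" "free_d q E0 (rel_ca q) = const (q\<^sup>2 + 1) * rel_ca q"
    "free_d q Ep (rel_db q) = 0" "free_d q Em (rel_db q) = rel_da q - rel_ad q - const (inverse q) * rel_bc"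
    "free_d q E0 (rel_db q) = const (- (inverse (q ^ 4) + inverse (q\<^sup>2))) * rel_db q"
    "free_d q Ep (rel_dc q) = 0" "free_d q Em (rel_dc q) = 0" "free_d q E0 (rel_dc q) = 0"
    "free_d q Ep rel_bc = - rel_db q" "free_d q Em rel_bc = - rel_ca q" "free_d q E0 rel_bc = 0"
    "free_d q Ep (rel_ad q) = 0" "free_d q Em (rel_ad q) = 0" "free_d q E0 (rel_ad q) = 0"
    "free_d q Ep (rel_da q) = const q * rel_db q" "free_d q Em (rel_da q) = const q * rel_ca q"
    "free_d q E0 (rel_da q) = 0"
  using assms
  apply (simp_all add: rel_defs free_d_diff free_d_add free_d_mult free_twist_mult[OF assms] free_twist_gen)
  apply (simp_all add: free_one_single monomial_simps power_int_minus field_simps)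
  \<comment> \<open>The identities still open are compared coefficient by coefficient.\<close>
  apply (rule poly_mapping_eqI; simp add: lookup_simps field_simps eval_nat_numeral)+
  done

lemma free_d_ideal:
  assumes "q \<noteq> 0" "f \<in> sl2_ideal q"
  shows "free_d q i f \<in> sl2_ideal q"
proof -
  \<comment> \<open>Membership in the ideal is carried along because the Leibniz term
    \<open>x * dy\<close> lies in the ideal through \<open>x\<close>, not through
    \<open>dx\<close>.\<close>
  let ?J = "{f \<in> sl2_ideal q. free_d q i f \<in> sl2_ideal q}"
  have "sl2_ideal q \<subseteq> ?J"
  proof (rule sl2_ideal_subset)
    show "r \<in> ?J" if "r \<in> sl2_relators q" for r
      using that sl2_relator_mem[of q] unfolding sl2_relators_eq
      by (cases i) (auto simp: free_d_relators[OF assms(1)] intro!: sl2.mem_add sl2.mem_diff sl2.mem_lmul sl2.mem_uminus)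
  qed (simp_all add: free_d_mult[OF assms(1)] free_d_add free_twist_ideal[OF assms(1)]
         sl2.mem_add sl2.mem_lmul sl2.mem_rmul)
  with assms(2) show ?thesis by auto
qed

lemma twist_cls:
  assumes "q \<noteq> 0"
  shows "twist q k (cls q f) = cls q (free_twist q k f)"
  unfolding twist_def by (intro descend_cls free_twist_ideal[OF assms] free_twist_add)

lemma differential_cls:
  assumes "q \<noteq> 0"
  shows "differential q (cls q f) i = cls q (free_d q i f)"
  unfolding differential_def by (intro descend_cls free_d_ideal[OF assms] free_d_add)

section \<open>The multiplication map on \<open>\<Omega>\<^sup>1\<^sup>,\<^sup>0 \<otimes> \<E>\<^sub>-\<^sub>n\<close>\<close>

text \<open>The universal property, stated with the same finite product as in
  \<open>tensor_mult\<close>, so that the multiplication map is a homomorphism before passing to the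
  quotient.\<close>

lemma (in comm_group) free_Abelian_group_extension:
  fixes \<phi> :: "'c \<Rightarrow> 'a"
  assumes "\<phi> ` S \<subseteq> carrier G"
  defines "\<Phi> \<equiv> \<lambda>f. finprod G (\<lambda>p. \<phi> p [^] Poly_Mapping.lookup f p) (Poly_Mapping.keys f)"
  shows "\<Phi> \<in> hom (free_Abelian_group S) G"
    and "p \<in> S \<Longrightarrow> \<Phi> (frag_of p) = \<phi> p"
proof -
  have \<phi>: "p \<in> S \<Longrightarrow> \<phi> p \<in> carrier G" for p
    using assms(1) by auto
  \<comment> \<open>Generators with coefficient 0 contribute the neutral element; this allows one
    index set for both summands and for their sum.\<close>
  have extend: "\<Phi> f = finprod G (\<lambda>p. \<phi> p [^] Poly_Mapping.lookup f p) A"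
    if "Poly_Mapping.keys f \<subseteq> A" "finite A" "A \<subseteq> S" for f A
    unfolding \<Phi>_def using that \<phi>
    by (intro finprod_mono_neutral_cong_left) (auto simp: in_keys_iff)
  show "\<Phi> \<in> hom (free_Abelian_group S) G"
  proof (rule homI)
    show "\<Phi> f \<in> carrier G" if "f \<in> carrier (free_Abelian_group S)" for f
      using that \<phi> unfolding \<Phi>_def by (auto intro!: finprod_closed)
    fix f g assume fg: "f \<in> carrier (free_Abelian_group S)" "g \<in> carrier (free_Abelian_group S)"
    let ?A = "Poly_Mapping.keys f \<union> Poly_Mapping.keys g"
    have A: "?A \<subseteq> S" "Poly_Mapping.keys (f + g) \<subseteq> ?A"
      using fg keys_add[of f g] by auto
    have "\<Phi> (f + g) = finprod G (\<lambda>p. \<phi> p [^] Poly_Mapping.lookup f p \<otimes> \<phi> p [^] Poly_Mapping.lookup g p) ?A"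
      using A \<phi> by (subst extend[of _ ?A]) (auto simp: lookup_add int_pow_mult intro!: finprod_cong')
    also have "\<dots> = \<Phi> f \<otimes> \<Phi> g"
    proof -
      have "(\<lambda>p. \<phi> p [^] Poly_Mapping.lookup h p) \<in> ?A \<rightarrow> carrier G" for h :: "'c \<Rightarrow>\<^sub>0 int"
        using A(1) \<phi> by auto
      then show ?thesis
        using A(1) by (simp add: extend[of _ ?A] finprod_multf)
    qed
    finally show "\<Phi> (f \<otimes>\<^bsub>free_Abelian_group S\<^esub> g) = \<Phi> f \<otimes> \<Phi> g"
      by simp
  qed
  show "\<Phi> (frag_of p) = \<phi> p" if "p \<in> S"
    using \<phi>[OF that] by (simp add: \<Phi>_def keys_frag_of)
qed

section \<open>The group of one-forms and its \<open>e^+\<close> part\<close>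

lemma comm_group_product_group:
  assumes "\<And>i. i \<in> I \<Longrightarrow> comm_group (G i)"
  shows "comm_group (product_group I G)"
proof (rule group.group_comm_groupI)
  show "group (product_group I G)"
    by (intro product_group comm_group.axioms(2) assms)
qed (use assms in \<open>auto simp: fun_eq_iff PiE_iff comm_group.axioms(1) comm_monoid.m_comm\<close>)

lemma comm_group_Omega: "comm_group (Omega q)"
  unfolding Omega_def
  by (intro comm_group_product_group abelian_group.a_comm_group ring.is_abelian_group ring_SLq)

lemma Omega_mult [simp]: "\<omega> \<otimes>\<^bsub>Omega q\<^esub> \<omega>' = (\<lambda>i. \<omega> i \<oplus>\<^bsub>SLq q\<^esub> \<omega>' i)"
  by (simp add: Omega_def restrict_UNIV)

lemma mem_carrier_Omega: "\<omega> \<in> carrier (Omega q) \<longleftrightarrow> (\<forall>i. \<omega> i \<in> carrier (SLq q))"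
  by (auto simp: Omega_def PiE_iff)

lemma SLq_deg_eq: "SLq_deg q m = cls q ` {f. homog m f}"
  by (auto simp: SLq_deg_def homog_def)

text \<open>This is \<open>u e^+\<close> for a representative \<open>u\<close> in the free algebra.
  The elements of \<open>Omega10\<close> and the values of \<open>D\<close> on combinations of words
  in \<open>a\<close> and \<open>c\<close> have this shape.\<close>

definition ep_form :: "complex \<Rightarrow> free \<Rightarrow> form" where
  "ep_form q u = (\<lambda>i. cls q (if i = Ep then u else 0))"

lemma ep_form_carrier: "ep_form q u \<in> carrier (Omega q)"
  by (simp add: mem_carrier_Omega ep_form_def)

lemma ep_form_add: "ep_form q u \<otimes>\<^bsub>Omega q\<^esub> ep_form q v = ep_form q (u + v)"
  by (simp add: ep_form_def fun_eq_iff)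

lemma Omega10_eq: "Omega10 q = ep_form q ` {u. homog (- 2) u}"
proof -
  have "lmul q (cls q u) (basis_form q Ep) = ep_form q u" for u
    by (simp add: lmul_def basis_form_def ep_form_def SLq_one SLq_zero fun_eq_iff)
  then show ?thesis
    by (auto simp: Omega10_def SLq_deg_eq) (metis imageI mem_Collect_eq)
qed

lemma rmul_ep_form:
  assumes "q \<noteq> 0"
  shows "rmul q (ep_form q u) (cls q g) = ep_form q (u * free_twist q 1 g)"
  by (simp add: rmul_def ep_form_def twist_cls[OF assms] fun_eq_iff)

text \<open>Inserting \<open>1 = da - q bc\<close> into itself, as \<open>1 = d 1 a - q b 1 c\<close>, writes \<open>1\<close> as a sum of
  products of elements of degree \<open>-2\<close> with elements of degree \<open>2\<close>.\<close>

lemma cls_unit_decomposition: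
  "cls q x = cls q (gen GD * gen GD * (gen GA * gen GA * x)
     + (- const q * (gen GD * gen GB)) * (gen GC * gen GA * x)
     + (- const q * (gen GB * gen GD)) * (gen GA * gen GC * x)
     + (const (q\<^sup>2) * (gen GB * gen GB)) * (gen GC * gen GC * x))"
    (is "_ = cls q ?y")
proof -
  \<comment> \<open>On the right, the first two summands replace the inner factor by 1 in
    \<open>d(da - q bc)a - q b(da - q bc)c\<close>, which leaves \<open>da - q bc\<close>; the third
    replaces this by 1 as well.\<close>
  have "gen GD * gen GD * (gen GA * gen GA)
     + (- const q * (gen GD * gen GB)) * (gen GC * gen GA)
     + (- const q * (gen GB * gen GD)) * (gen GA * gen GC)
     + (const (q\<^sup>2) * (gen GB * gen GB)) * (gen GC * gen GC) - 1
    = gen GD * rel_da q * gen GA - const q * gen GB * rel_da q * gen GC + rel_da q"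
    (is "?z - 1 = ?r")
    by (simp add: rel_defs ring_distribs)
      (simp add: free_one_single monomial_simps ring_distribs power2_eq_square)
  moreover have "?r \<in> sl2_ideal q"
    by (intro sl2.mem_add sl2.mem_diff sl2.mem_lmul sl2.mem_rmul sl2_relator_mem)
  ultimately have "(?z - 1) * x \<in> sl2_ideal q"
    by (simp add: sl2.mem_rmul)
  moreover have "(?z - 1) * x = ?y - x"
    by (simp add: algebra_simps)
  ultimately show ?thesis
    using cls_eq_iff by metis
qed

text \<open>Two things are needed. \<open>tensor_mult\<close> is defined through representatives, so
  the map on the free abelian group must kill the tensor relators. And multiplying the decomposition
  of 1 by \<open>x\<close> writes \<open>x\<close> with factors of degrees \<open>-2\<close> and
  \<open>n\<close>.\<close>

lemma hol_tensor_ep_form: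
  assumes q: "q \<noteq> 0" and x: "homog (int n - 2) x"
  shows "\<exists>t\<in>carrier (hol_tensor q n). tensor_mult q t = ep_form q x"
proof -
  define S where "S = Omega10 q \<times> monopole q n"
  define F where "F = free_Abelian_group S"
  define \<phi> where "\<phi> = (\<lambda>p. rmul q (fst p) (snd p))"
  define \<Phi> where "\<Phi> = (\<lambda>f :: (form \<times> free set) \<Rightarrow>\<^sub>0 int. finprod (Omega q) (\<lambda>p. \<phi> p [^]\<^bsub>Omega q\<^esub> Poly_Mapping.lookup f p)
    (Poly_Mapping.keys f))"
  define rels where "rels = tensor_relators ((Omega q)\<lparr>carrier := Omega10 q\<rparr>) (rmul q) (sphere q)
       (\<lambda>x y. x \<otimes>\<^bsub>SLq q\<^esub> y) ((add_monoid (SLq q))\<lparr>carrier := monopole q n\<rparr>)"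
  define T where "T = generate F rels"
  interpret O: comm_group "Omega q"
    by (rule comm_group_Omega)
  interpret F: group F
    by (simp add: F_def)
  have S_iff: "p \<in> S \<longleftrightarrow> (\<exists>u g. p = (ep_form q u, cls q g) \<and> homog (- 2) u \<and> homog (int n) g)" for p
    by (auto simp: S_def Omega10_eq monopole_def SLq_deg_eq)
  have \<phi>_eq: "\<phi> (ep_form q u, cls q g) = ep_form q (u * free_twist q 1 g)" for u g
    by (simp add: \<phi>_def rmul_ep_form[OF q])
  have \<phi>: "\<phi> ` S \<subseteq> carrier (Omega q)"
    by (auto simp: S_iff \<phi>_eq ep_form_carrier)
  interpret \<Phi>: group_hom F "Omega q" \<Phi>
    using O.free_Abelian_group_extension(1)[OF \<phi>] unfolding F_def \<Phi>_def
    by (intro group_hom.intro group_hom_axioms.intro group_free_Abelian_group O.group_axioms)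
  have \<Phi>_frag: "\<Phi> (frag_of p) = \<phi> p" if "p \<in> S" for p
    using O.free_Abelian_group_extension(2)[OF \<phi> that] by (simp add: \<Phi>_def)
  have F_simps: "frag_of p \<in> carrier F \<longleftrightarrow> p \<in> S" "f \<otimes>\<^bsub>F\<^esub> g = f + g" for p f g
    by (simp_all add: F_def)
  have inF: "f + g \<in> carrier F" "f - g \<in> carrier F" if "f \<in> carrier F" "g \<in> carrier F" for f g
    using that keys_add[of f g] keys_diff[of f g] unfolding F_def by auto
  \<comment> \<open>Relators are differences, while the homomorphism law concerns sums. This reduces
    membership in the kernel to the equality of two values.\<close>
  have ker: "f - g \<in> kernel F (Omega q) \<Phi>"
    if "f \<in> carrier F" "g \<in> carrier F" "\<Phi> f = \<Phi> g" for f g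
  proof -
    have "\<Phi> (f - g) \<otimes>\<^bsub>Omega q\<^esub> \<Phi> g = \<Phi> ((f - g) \<otimes>\<^bsub>F\<^esub> g)"
      using that by (intro \<Phi>.hom_mult[symmetric] inF)
    also have "\<dots> = \<Phi> g"
      by (simp add: F_simps that)
    finally have "\<Phi> (f - g) = \<one>\<^bsub>Omega q\<^esub>"
      using that inF \<Phi>.hom_closed by (metis O.r_cancel_one)
    with that show ?thesis
      by (simp add: kernel_def inF)
  qed
  have "rels \<subseteq> kernel F (Omega q) \<Phi>"
  proof -
    have "frag_of (\<omega> \<otimes>\<^bsub>Omega q\<^esub> \<omega>', \<sigma>) - frag_of (\<omega>, \<sigma>) - frag_of (\<omega>', \<sigma>) \<in> kernel F (Omega q) \<Phi>"
      if "\<omega> \<in> Omega10 q" "\<omega>' \<in> Omega10 q" "\<sigma> \<in> monopole q n" for \<omega> \<omega>' \<sigma>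
    proof -
      obtain u u' g where e: "\<omega> = ep_form q u" "\<omega>' = ep_form q u'" "\<sigma> = cls q g"
        and h: "homog (- 2) u" "homog (- 2) u'" "homog (int n) g"
        using \<open>\<omega> \<in> _\<close> \<open>\<omega>' \<in> _\<close> \<open>\<sigma> \<in> _\<close> by (auto simp: Omega10_eq monopole_def SLq_deg_eq)
      have S: "(\<omega>, \<sigma>) \<in> S" "(\<omega>', \<sigma>) \<in> S" "(\<omega> \<otimes>\<^bsub>Omega q\<^esub> \<omega>', \<sigma>) \<in> S"
        unfolding S_iff e ep_form_add using h homog_add by blast+
      have "\<Phi> (frag_of (\<omega>, \<sigma>) + frag_of (\<omega>', \<sigma>)) = \<phi> (\<omega>, \<sigma>) \<otimes>\<^bsub>Omega q\<^esub> \<phi> (\<omega>', \<sigma>)"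
        using S \<Phi>.hom_mult[of "frag_of (\<omega>, \<sigma>)" "frag_of (\<omega>', \<sigma>)"] by (simp add: F_simps \<Phi>_frag)
      also have "\<dots> = \<Phi> (frag_of (\<omega> \<otimes>\<^bsub>Omega q\<^esub> \<omega>', \<sigma>))"
        unfolding \<Phi>_frag[OF S(3)] unfolding e ep_form_add \<phi>_eq by (simp add: distrib_right)
      finally show ?thesis
        unfolding diff_diff_add using S by (intro ker inF) (simp_all only: F_simps)
    qed
    moreover have "frag_of (\<omega>, \<sigma> \<oplus>\<^bsub>SLq q\<^esub> \<sigma>') - frag_of (\<omega>, \<sigma>) - frag_of (\<omega>, \<sigma>') \<in> kernel F (Omega q) \<Phi>"
      if "\<omega> \<in> Omega10 q" "\<sigma> \<in> monopole q n" "\<sigma>' \<in> monopole q n" for \<omega> \<sigma> \<sigma>'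
    proof -
      obtain u g g' where e: "\<omega> = ep_form q u" "\<sigma> = cls q g" "\<sigma>' = cls q g'"
        and h: "homog (- 2) u" "homog (int n) g" "homog (int n) g'"
        using \<open>\<omega> \<in> _\<close> \<open>\<sigma> \<in> _\<close> \<open>\<sigma>' \<in> _\<close> by (auto simp: Omega10_eq monopole_def SLq_deg_eq)
      have S: "(\<omega>, \<sigma>) \<in> S" "(\<omega>, \<sigma>') \<in> S" "(\<omega>, \<sigma> \<oplus>\<^bsub>SLq q\<^esub> \<sigma>') \<in> S"
        unfolding S_iff e SLq_simps using h homog_add by blast+
      have "\<Phi> (frag_of (\<omega>, \<sigma>) + frag_of (\<omega>, \<sigma>')) = \<phi> (\<omega>, \<sigma>) \<otimes>\<^bsub>Omega q\<^esub> \<phi> (\<omega>, \<sigma>')"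
        using S \<Phi>.hom_mult[of "frag_of (\<omega>, \<sigma>)" "frag_of (\<omega>, \<sigma>')"] by (simp add: F_simps \<Phi>_frag)
      also have "\<dots> = \<Phi> (frag_of (\<omega>, \<sigma> \<oplus>\<^bsub>SLq q\<^esub> \<sigma>'))"
        unfolding \<Phi>_frag[OF S(3)] unfolding e SLq_simps ep_form_add \<phi>_eq
        by (simp add: distrib_left free_twist_add)
      finally show ?thesis
        unfolding diff_diff_add using S by (intro ker inF) (simp_all only: F_simps)
    qed
    moreover have "frag_of (rmul q \<omega> b, \<sigma>) - frag_of (\<omega>, b \<otimes>\<^bsub>SLq q\<^esub> \<sigma>) \<in> kernel F (Omega q) \<Phi>"
      if "\<omega> \<in> Omega10 q" "b \<in> sphere q" "\<sigma> \<in> monopole q n" for \<omega> b \<sigma>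
    proof -
      obtain u g h where e: "\<omega> = ep_form q u" "b = cls q h" "\<sigma> = cls q g"
        and h: "homog (- 2) u" "homog 0 h" "homog (int n) g"
        using \<open>\<omega> \<in> _\<close> \<open>\<sigma> \<in> _\<close> \<open>b \<in> _\<close> by (auto simp: Omega10_eq monopole_def sphere_def SLq_deg_eq)
      \<comment> \<open>The twist is trivial on \<open>h\<close> of degree 0, so the right action of
        the sphere preserves degree \<open>-2\<close>.\<close>
      have "homog (- 2) (u * free_twist q 1 h)" "homog (int n) (h * g)"
        using homog_mult[OF h(1,2)] homog_mult[OF h(2,3)] by (simp_all add: free_twist_homog[OF h(2)])
      then have S: "(rmul q \<omega> b, \<sigma>) \<in> S" "(\<omega>, b \<otimes>\<^bsub>SLq q\<^esub> \<sigma>) \<in> S"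
        unfolding S_iff e SLq_simps rmul_ep_form[OF q] using h by blast+
      \<comment> \<open>Balancedness comes from the multiplicativity of the twist on
        \<open>h * g\<close>.\<close>
      have "\<Phi> (frag_of (rmul q \<omega> b, \<sigma>)) = \<Phi> (frag_of (\<omega>, b \<otimes>\<^bsub>SLq q\<^esub> \<sigma>))"
        unfolding S[THEN \<Phi>_frag] unfolding e SLq_simps rmul_ep_form[OF q] \<phi>_eq
        by (simp add: free_twist_mult[OF q] mult.assoc)
      then show ?thesis
        using S by (intro ker) (simp_all only: F_simps)
    qed
    ultimately show ?thesis
      unfolding rels_def tensor_relators_def by auto
  qed
  then have T: "T \<subseteq> kernel F (Omega q) \<Phi>"
    unfolding T_def by (rule F.generate_subgroup_incl[OF _ \<Phi>.subgroup_kernel])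
  \<comment> \<open>\<Phi> is constant on each coset of \<open>T\<close>, and cosets are nonempty,
    so \<open>the_elem\<close> returns that constant.\<close>
  have tensor_mult: "tensor_mult q (T #>\<^bsub>F\<^esub> f) = \<Phi> f" if f: "f \<in> carrier F" for f
  proof -
    have "\<Phi> (h \<otimes>\<^bsub>F\<^esub> f) = \<Phi> f" if "h \<in> T" for h
    proof -
      have "h \<in> carrier F" "\<Phi> h = \<one>\<^bsub>Omega q\<^esub>"
        using that T by (auto simp: kernel_def)
      then show ?thesis
        using f by (simp add: \<Phi>.hom_mult del: Omega_mult)
    qed
    then have "\<Phi> ` (T #>\<^bsub>F\<^esub> f) \<subseteq> {\<Phi> f}"
      unfolding r_coset_def by blast
    moreover have "T #>\<^bsub>F\<^esub> f \<noteq> {}"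
      unfolding r_coset_def T_def using generate.one[of F rels] by blast
    ultimately have "\<Phi> ` (T #>\<^bsub>F\<^esub> f) = {\<Phi> f}"
      by (simp add: subset_singleton_iff)
    then show ?thesis
      by (simp add: tensor_mult_def \<Phi>_def \<phi>_def)
  qed
  have image_mult: "\<exists>f\<in>carrier F. \<Phi> f = ep_form q (u * g)" if "homog (- 2) u" "homog (int n) g" for u g
  proof
    \<comment> \<open>The scalar undoes the factor \<open>q^n\<close> that appears when
      \<open>e^+\<close> passes \<open>g\<close> of degree \<open>n\<close>.\<close>
    let ?u = "const (q powi (- int n)) * u"
    have S: "(ep_form q ?u, cls q g) \<in> S"
      using that homog_const_mult S_iff by blast
    then show "frag_of (ep_form q ?u, cls q g) \<in> carrier F"
      by (simp only: F_simps)
    have "?u * (const (q powi int n) * g) = (const (q powi (- int n)) * const (q powi int n)) * (u * g)"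
      by (simp only: const_left_commute[of u] mult.assoc)
    also have "\<dots> = u * g"
      using q by (simp add: power_int_minus flip: const_mult)
    finally show "\<Phi> (frag_of (ep_form q ?u, cls q g)) = ep_form q (u * g)"
      by (simp add: \<Phi>_frag[OF S] \<phi>_eq free_twist_homog[OF that(2)])
  qed
  have image_add: "\<exists>f\<in>carrier F. \<Phi> f = ep_form q (u + v)"
    if "\<exists>f\<in>carrier F. \<Phi> f = ep_form q u" "\<exists>f\<in>carrier F. \<Phi> f = ep_form q v" for u v
  proof -
    from that(1) obtain f where "f \<in> carrier F" "\<Phi> f = ep_form q u" ..
    moreover from that(2) obtain g where "g \<in> carrier F" "\<Phi> g = ep_form q v" ..
    ultimately show ?thesis
      by (intro bexI[of _ "f \<otimes>\<^bsub>F\<^esub> g"]) (simp_all only: F.m_closed \<Phi>.hom_mult ep_form_add)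
  qed
  have minus2: "homog (- 2) (gen GD * gen GD)" "homog (- 2) (- const q * (gen GD * gen GB))"
    "homog (- 2) (- const q * (gen GB * gen GD))" "homog (- 2) (const (q\<^sup>2) * (gen GB * gen GB))"
    unfolding const_uminus[symmetric] by (intro homog_const_mult homog_gen2; simp)+
  have n: "homog (int n) (gen y * gen z * x)" if "deg y = 1" "deg z = 1" for y z
    using homog_mult[OF homog_gen2[of y z 2] x] that by simp
  let ?y = "gen GD * gen GD * (gen GA * gen GA * x)
     + (- const q * (gen GD * gen GB)) * (gen GC * gen GA * x)
     + (- const q * (gen GB * gen GD)) * (gen GA * gen GC * x)
     + (const (q\<^sup>2) * (gen GB * gen GB)) * (gen GC * gen GC * x)"
  have "\<exists>f\<in>carrier F. \<Phi> f = ep_form q ?y"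
    by (intro image_add image_mult minus2 n deg.simps)
  then obtain f where "f \<in> carrier F" "\<Phi> f = ep_form q ?y" ..
  moreover have "ep_form q ?y = ep_form q x"
    unfolding ep_form_def fun_eq_iff using cls_unit_decomposition[of q x] by simp
  ultimately have f: "f \<in> carrier F" "\<Phi> f = ep_form q x"
    by simp_all
  have "T #>\<^bsub>F\<^esub> f \<in> carrier (hol_tensor q n)"
    using f(1) by (auto simp: hol_tensor_def tensor_group_def Let_def FactGroup_def RCOSETS_def
        T_def rels_def F_def S_def)
  then show ?thesis
    using f by (intro bexI[of _ "T #>\<^bsub>F\<^esub> f"]) (simp_all only: tensor_mult)
qed

section \<open>Holomorphic sections\<close>

definition ac_words :: "nat \<Rightarrow> gen list set" where
  "ac_words n = {w. length w = n \<and> set w \<subseteq> {GA, GC}}"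

lemma ac_words_0: "ac_words 0 = {[]}"
  by (auto simp: ac_words_def)

lemma ac_words_Suc: "ac_words (Suc n) = (#) GA ` ac_words n \<union> (#) GC ` ac_words n"
  by (auto simp: ac_words_def length_Suc_conv)

lemma ac_words_induct [consumes 1, case_names Nil Cons]:
  assumes "w \<in> ac_words n" "P 0 []"
    "\<And>n x w. x \<in> {GA, GC} \<Longrightarrow> w \<in> ac_words n \<Longrightarrow> P n w \<Longrightarrow> P (Suc n) (x # w)"
  shows "P n w"
  using assms(1) by (induction n arbitrary: w) (auto simp: ac_words_0 ac_words_Suc assms(2,3))

lemma word_Cons: "word (x # w) = gen x * word w"
  by (simp add: word_mult plus_list_def)

lemma word_Nil: "word ([] :: gen list) = 1"
  by (simp add: word_def free_one_single)

lemma ac_words_deg: "w \<in> ac_words n \<Longrightarrow> word_deg w = int n"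
  by (induction rule: ac_words_induct) (auto simp: word_deg_def)

text \<open>The value \<open>n\<close> at \<open>p = 1\<close> keeps the recursion valid there, so
  \<open>q^2 = 1\<close> needs no separate treatment later.\<close>

lemma qint_0: "qint 0 p = 0"
  and qint_Suc: "qint (Suc n) p = p ^ n + qint n p"
  by (auto simp: qint_def field_simps)

text \<open>For a new letter \<open>x\<close> in front of \<open>w\<close>, moving
  \<open>e^0\<close> past \<open>w\<close> gives \<open>q^(2n)\<close>, the summand in
  \<open>qint_Suc\<close>. In the \<open>e^+\<close> component \<open>a\<close> or \<open>c\<close>
  is replaced by \<open>q b\<close> or \<open>q d\<close>, which lowers the degree by 2.\<close>

lemma d_word_ac:
  assumes "w \<in> ac_words n"
  shows "d_word q w Em = 0" "d_word q w E0 = const (qint n (q\<^sup>2)) * word w"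
    "homog (int n - 2) (d_word q w Ep)"
proof -
  show "d_word q w Em = 0"
    using assms by (induction rule: ac_words_induct) auto
  show "d_word q w E0 = const (qint n (q\<^sup>2)) * word w"
    using assms
  proof (induction rule: ac_words_induct)
    case (Cons n x w)
    have "free_twist q 2 (word w) = const ((q\<^sup>2) ^ n) * word w"
      using free_twist_homog[OF homog_word[of w], of q 2] ac_words_deg[OF Cons(2)]
      by (simp add: power_int_mult)
    moreover have "d_gen q x E0 = gen x"
      using Cons(1) by auto
    ultimately show ?case
      by (simp add: word_Cons[of x w] Cons.IH const_left_commute[of "gen x"] qint_Suc const_add distrib_right)
  qed (simp add: qint_0)
  show "homog (int n - 2) (d_word q w Ep)"
    using assms
  proof (induction rule: ac_words_induct)
    case (Cons n x w)
    have "homog (int n) (free_twist q 1 (word w))"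
      using free_twist_homog[OF homog_word[of w], of q 1] homog_word[of w] ac_words_deg[OF Cons(2)]
      by (simp add: homog_const_mult)
    moreover have "homog (- 1) (d_gen q x Ep)" "deg x = 1"
      using Cons(1) homog_const_mult[OF homog_gen[of GB]] homog_const_mult[OF homog_gen[of GD]] by auto
    ultimately have "homog (- 1 + int n) (d_gen q x Ep * free_twist q 1 (word w))"
      "homog (1 + (int n - 2)) (gen x * d_word q w Ep)"
      using homog_mult[of "- 1" _ "int n"] homog_mult[OF homog_gen[of x] Cons.IH] by simp_all
    then show ?case
      by (simp add: homog_add)
  qed simp
qed

lemma free_d_ac:
  assumes "Poly_Mapping.keys f \<subseteq> ac_words n"
  shows "free_d q Em f = 0" "free_d q E0 f = const (qint n (q\<^sup>2)) * f"
    "homog (int n - 2) (free_d q Ep f)" "homog (int n) f"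
proof -
  have single: "Poly_Mapping.single w z = const z * word w"
    "free_d q i (const z * word w) = const z * d_word q w i" for w :: "gen list" and z i
    by (simp add: word_single) (simp add: free_d_def lin_ext_const)
  show "free_d q Em f = 0" "free_d q E0 f = const (qint n (q\<^sup>2)) * f"
    using assms by (induction rule: supported_induct)
      (simp_all add: free_d_add distrib_left d_word_ac single const_left_commute[of "const _"])
  show "homog (int n - 2) (free_d q Ep f)"
    using assms by (induction rule: supported_induct)
      (simp_all add: free_d_add homog_add d_word_ac single homog_const_mult)
  show "homog (int n) f"
    using assms ac_words_deg by (auto simp: homog_def)
qed

text \<open>The term subtracted in \<open>monopole_D\<close> is exactly the \<open>e^0\<close>
  component of the differential.\<close>

lemma monopole_D_ac:
  assumes q: "q \<noteq> 0" and f: "Poly_Mapping.keys f \<subseteq> ac_words n"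
  shows "monopole_D q n (cls q f) = ep_form q (free_d q Ep f)"
proof
  fix i
  show "monopole_D q n (cls q f) i = ep_form q (free_d q Ep f) i"
    by (cases i) (simp_all add: monopole_D_def differential_cls[OF q] lmul_def basis_form_def
        ep_form_def SLq_one SLq_zero free_d_ac[OF f])
qed

lemma ac_holomorphic:
  assumes "q \<noteq> 0" "Poly_Mapping.keys f \<subseteq> ac_words n"
  shows "cls q f \<in> hol_sections q n"
proof -
  have "cls q f \<in> monopole q n"
    using free_d_ac(4)[OF assms(2)] by (auto simp: monopole_def SLq_deg_eq)
  then show ?thesis
    using hol_tensor_ep_form[OF assms(1) free_d_ac(3)[OF assms(2), of q]]
    by (simp add: hol_sections_def monopole_D_ac[OF assms])
qed

section \<open>A representation separating the monomials\<close>

text \<open>The action on Laurent polynomials in one variable \<open>x\<close> (with \<open>x\<^sup>j\<close> the single \<open>j\<close>) by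
  \<open>a = x\<close>, \<open>b = 0\<close>, \<open>d = x\<^sup>-\<^sup>1\<close> and \<open>c\<close> the dilation \<open>x \<mapsto> q x\<close>.\<close>

definition act :: "complex \<Rightarrow> gen \<Rightarrow> (int \<Rightarrow>\<^sub>0 complex) \<Rightarrow> (int \<Rightarrow>\<^sub>0 complex)" where
  "act q x = lin_ext (\<lambda>j. case x of
     GA \<Rightarrow> Poly_Mapping.single (j + 1) 1
   | GB \<Rightarrow> 0
   | GC \<Rightarrow> Poly_Mapping.single j (q powi j)
   | GD \<Rightarrow> Poly_Mapping.single (j - 1) 1)"

text \<open>\<open>foldr\<close> lets the last letter act first, so concatenation of words becomes
  composition and a left module results.\<close>

definition rep :: "complex \<Rightarrow> free \<Rightarrow> (int \<Rightarrow>\<^sub>0 complex) \<Rightarrow> (int \<Rightarrow>\<^sub>0 complex)" where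
  "rep q f v = lin_ext (\<lambda>w. foldr (act q) w v) f"

lemma foldr_act_linear:
  "foldr (act q) w 0 = 0"
  "foldr (act q) w (u + v) = foldr (act q) w u + foldr (act q) w v"
  "foldr (act q) w (const z * v) = const z * foldr (act q) w v"
  by (induction w) (simp_all add: act_def lin_ext_add lin_ext_const)

lemma rep_simps [simp]:
  "rep q 0 v = 0" "rep q f 0 = 0"
  "rep q (f + g) v = rep q f v + rep q g v"
  "rep q (f - g) v = rep q f v - rep q g v"
  "rep q (- f) v = - rep q f v"
  "rep q (const z) v = const z * v"
  "rep q (gen x) v = act q x v"
  "rep q 1 v = v"
  by (simp_all add: rep_def lin_ext_add lin_ext_diff lin_ext_uminus lin_ext_const
      foldr_act_linear free_one_single) (simp_all add: lin_ext_def const_def zero_list_def foldr_act_linear)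

lemma rep_add: "rep q f (u + v) = rep q f u + rep q f v"
  by (induction f rule: pm_induct)
    (simp_all add: rep_def lin_ext_add foldr_act_linear algebra_simps)

lemma rep_mult [simp]: "rep q (f * g) v = rep q f (rep q g v)"
proof (induction f rule: pm_induct)
  case (single u x)
  show ?case
  proof (induction g rule: pm_induct)
    case (single w y)
    show ?case
      by (simp add: rep_def mult_single plus_list_def foldr_act_linear const_mult mult.assoc)
  qed (simp_all add: distrib_left rep_add)
qed (simp_all add: distrib_right)

text \<open>With \<open>b\<close> acting as 0 the remaining relations are \<open>ca = q ac\<close>,
  \<open>dc = q cd\<close> and \<open>ad = da = 1\<close>, which the shifts and the dilation satisfy
  on each \<open>x^j\<close>.\<close>

lemma rep_ideal:
  assumes "q \<noteq> 0" "f \<in> sl2_ideal q"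
  shows "rep q f v = 0"
proof -
  have "sl2_ideal q \<subseteq> {f. \<forall>v. rep q f v = 0}"
  proof (rule sl2_ideal_subset)
    show "r \<in> {f. \<forall>v. rep q f v = 0}" if r: "r \<in> sl2_relators q" for r
    proof (intro CollectI allI)
      fix v
      show "rep q r v = 0"
      proof (induction v rule: pm_induct)
        case (single j z)
        from r show ?case
          unfolding sl2_relators_eq
          by (elim insertE emptyE; hypsubst)
            (simp_all add: rel_defs act_def const_times_single power_int_add power_int_diff assms(1)
              single_times_const mult.commute mult.left_commute)
      qed (simp_all add: rep_add)
    qed
  qed auto
  with assms(2) show ?thesis by auto
qed

lemma rep_cong:
  assumes "q \<noteq> 0" "cls q f = cls q g"
  shows "rep q f v = rep q g v"
proof -
  have "rep q (f - g) v = 0"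
    by (rule rep_ideal) (use assms cls_eq_iff in auto)
  then show ?thesis by simp
qed

definition ac_mono :: "nat \<Rightarrow> nat \<Rightarrow> free" where
  "ac_mono n s = gen GC ^ s * gen GA ^ (n - s)"

text \<open>The vector \<open>1\<close> is \<open>x^0\<close>. Different \<open>s\<close> give
  different exponents, with nonzero coefficients when \<open>q\<close> is nonzero, so these images
  separate the monomials.\<close>

lemma rep_ac_mono:
  assumes "s \<le> n"
  shows "rep q (ac_mono n s) 1
    = Poly_Mapping.single (int n - int s) ((q powi (int n - int s)) ^ s)"
proof -
  have "rep q (gen GA ^ m) 1 = Poly_Mapping.single (int m) 1" for m
    by (induction m) (simp_all add: act_def add.commute)
  moreover have "rep q (gen GC ^ m) (Poly_Mapping.single j 1) = Poly_Mapping.single j ((q powi j) ^ m)" for m j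
    by (induction m) (simp_all add: act_def const_times_single power_commutes)
  ultimately show ?thesis
    using assms by (simp add: ac_mono_def of_nat_diff)
qed

section \<open>The standard corepresentation\<close>

text \<open>The results on spans and dimension used below ask for a subfield. The scalars form one
  as soon as the quotient is not the zero ring.\<close>

lemma subfield_scalars:
  assumes "q \<noteq> 0"
  shows "subfield (scalars q) (SLq q)"
proof -
  interpret R: ring "SLq q"
    by (rule ring_SLq)
  \<comment> \<open>Equal classes act equally on Laurent polynomials, but 1 acts as the identity and
    0 as zero.\<close>
  have one_zero: "cls q 1 \<noteq> cls q 0"
  proof
    assume "cls q 1 = cls q 0"
    from rep_cong[OF assms this, of 1] show False
      by simp
  qed
  show ?thesis
  proof (rule R.subfieldI)
    show "subcring (scalars q) (SLq q)"
    proof (intro R.subcringI R.subringI)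
      show "\<one>\<^bsub>SLq q\<^esub> \<in> scalars q"
        unfolding scalars_def SLq_one using const_1 by (metis rangeI)
      show "\<ominus>\<^bsub>SLq q\<^esub> x \<in> scalars q" if "x \<in> scalars q" for x
        using that by (auto simp: scalars_def simp flip: const_uminus)
      show "x \<otimes>\<^bsub>SLq q\<^esub> y \<in> scalars q" "x \<oplus>\<^bsub>SLq q\<^esub> y \<in> scalars q"
        if "x \<in> scalars q" "y \<in> scalars q" for x y
        using that by (auto simp: scalars_def simp flip: const_mult const_add)
      show "x \<otimes>\<^bsub>SLq q\<^esub> y = y \<otimes>\<^bsub>SLq q\<^esub> x" if "x \<in> scalars q" "y \<in> scalars q" for x y
        using that by (auto simp: scalars_def mult.commute simp flip: const_mult)
    qed (auto simp: scalars_def)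
    have inverse: "cls q (const (inverse z)) \<otimes>\<^bsub>SLq q\<^esub> cls q (const z) = cls q 1"
      "cls q (const z) \<otimes>\<^bsub>SLq q\<^esub> cls q (const (inverse z)) = cls q 1"
      if "cls q (const z) \<noteq> cls q 0" for z
    proof -
      have "z \<noteq> 0"
        using that by auto
      then show "cls q (const (inverse z)) \<otimes>\<^bsub>SLq q\<^esub> cls q (const z) = cls q 1"
        "cls q (const z) \<otimes>\<^bsub>SLq q\<^esub> cls q (const (inverse z)) = cls q 1"
        by (simp_all flip: const_mult)
    qed
    show "Units (SLq q\<lparr>carrier := scalars q\<rparr>) = scalars q - {\<zero>\<^bsub>SLq q\<^esub>}"
    proof (intro equalityI subsetI)
      fix x assume "x \<in> Units (SLq q\<lparr>carrier := scalars q\<rparr>)"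
      then obtain z y where "x = cls q (const z)" "y \<otimes>\<^bsub>SLq q\<^esub> x = \<one>\<^bsub>SLq q\<^esub>" "y \<in> scalars q"
        by (auto simp: Units_def scalars_def)
      with one_zero show "x \<in> scalars q - {\<zero>\<^bsub>SLq q\<^esub>}"
        by (auto simp: scalars_def SLq_one SLq_zero)
    next
      fix x assume "x \<in> scalars q - {\<zero>\<^bsub>SLq q\<^esub>}"
      then obtain z where "x = cls q (const z)" "cls q (const z) \<noteq> cls q 0"
        by (auto simp: scalars_def SLq_zero)
      with inverse[of z] show "x \<in> Units (SLq q\<lparr>carrier := scalars q\<rparr>)"
        unfolding Units_def scalars_def by (auto simp: SLq_one simp del: SLq_simps(2))
    qed
  qed
qed

text \<open>Subspaces of the quotient are described by linear conditions on representatives: below,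
  a condition on the support and the vanishing of a coefficient under \<open>rep\<close>.\<close>

lemma subalgebra_cls_image:
  assumes "P 0" "\<And>f g. P f \<Longrightarrow> P g \<Longrightarrow> P (f + g)" "\<And>z f. P f \<Longrightarrow> P (const z * f)"
  shows "subalgebra (scalars q) (cls q ` {f. P f}) (SLq q)"
proof -
  interpret R: ring "SLq q"
    by (rule ring_SLq)
  have "P (- f)" if "P f" for f
    using assms(3)[OF that, of "- 1"] by (simp add: const_uminus)
  then have "subgroup (cls q ` {f. P f}) (add_monoid (SLq q))"
    by (intro R.add.subgroupI) (use assms(1,2) in \<open>auto simp flip: a_inv_def\<close>)
  then show ?thesis
    by (rule subalgebra.intro) (unfold_locales, use assms(3) in \<open>auto simp: scalars_def\<close>)
qed

section \<open>Normal ordering and the span of the monomials\<close>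

lemma standard_corep_eq_Span:
  "standard_corep q n = ring.Span (SLq q) (scalars q) (map (\<lambda>s. cls q (ac_mono n s)) [0..<Suc n])"
  unfolding standard_corep_def ac_mono_def SLq_nat_pow SLq_simps ..

lemma cls_mult_cong: "cls q f = cls q f' \<Longrightarrow> cls q g = cls q g' \<Longrightarrow> cls q (f * g) = cls q (f' * g')"
  by (metis SLq_simps(2))

text \<open>By \<open>ca = q ac\<close>, moving \<open>a\<close> to the right past one
  \<open>c\<close> costs a factor \<open>q^-1\<close>.\<close>

lemma cls_a_c_power:
  assumes "q \<noteq> 0"
  shows "cls q (gen GA * gen GC ^ s) = cls q (const (inverse q ^ s) * (gen GC ^ s * gen GA))"
proof (induction s)
  case (Suc s)
  have "gen GA * gen GC - const (inverse q) * (gen GC * gen GA) = - const (inverse q) * rel_ca q"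
    using assms by (simp add: rel_defs right_diff_distrib flip: mult.assoc const_mult)
  then have ac: "cls q (gen GA * gen GC) = cls q (const (inverse q) * (gen GC * gen GA))"
    by (simp add: cls_eq_iff sl2.mem_lmul sl2.mem_uminus sl2_relator_mem)
  have "cls q (gen GA * gen GC ^ Suc s) = cls q (gen GA * gen GC * gen GC ^ s)"
    by (simp add: mult.assoc)
  also have "\<dots> = cls q (const (inverse q) * (gen GC * gen GA) * gen GC ^ s)"
    by (intro cls_mult_cong ac refl)
  also have "\<dots> = cls q (const (inverse q) * gen GC * (gen GA * gen GC ^ s))"
    by (simp add: mult.assoc)
  also have "\<dots> = cls q (const (inverse q) * gen GC * (const (inverse q ^ s) * (gen GC ^ s * gen GA)))"
    by (intro cls_mult_cong Suc.IH refl)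
  also have "\<dots> = cls q (const (inverse q ^ Suc s) * (gen GC ^ Suc s * gen GA))"
    by (simp add: mult.assoc const_left_commute[of "gen GC"] const_mult)
  finally show ?case .
qed simp

text \<open>Normal ordering by induction: a leading \<open>c\<close> joins the power of
  \<open>c\<close>, while a leading \<open>a\<close> is moved through \<open>c^s\<close> at the cost
  of \<open>q^-s\<close>.\<close>

lemma cls_ac_word:
  assumes "q \<noteq> 0" "w \<in> ac_words n"
  shows "\<exists>k s. s \<le> n \<and> cls q (word w) = cls q (const k * ac_mono n s)"
  using assms(2)
proof (induction rule: ac_words_induct)
  case Nil
  show ?case
    by (intro exI[of _ 1] exI[of _ 0]) (simp add: word_Nil ac_mono_def)
next
  case (Cons n x w)
  obtain k s where s: "s \<le> n" and IH: "cls q (word w) = cls q (const k * ac_mono n s)"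
    using Cons.IH by blast
  have eq: "cls q (word (x # w)) = cls q (const k * (gen x * ac_mono n s))"
    using cls_mult_cong[OF refl IH, of "gen x"] by (simp add: word_Cons[of x w] const_left_commute[of "gen x"])
  consider "x = GC" | "x = GA"
    using Cons(1) by auto
  then show ?case
  proof cases
    case 1
    then show ?thesis
      using s eq by (intro exI[of _ k] exI[of _ "Suc s"]) (simp add: ac_mono_def mult.assoc)
  next
    case 2
    have "cls q (gen GA * ac_mono n s) = cls q (const (inverse q ^ s) * (gen GC ^ s * gen GA) * gen GA ^ (n - s))"
      using cls_mult_cong[OF cls_a_c_power[OF assms(1), of s] refl] by (simp add: ac_mono_def mult.assoc)
    also have "\<dots> = cls q (const (inverse q ^ s) * ac_mono (Suc n) s)"
      using s by (simp add: ac_mono_def mult.assoc Suc_diff_le)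
    finally have "cls q (gen GA * ac_mono n s) = cls q (const (inverse q ^ s) * ac_mono (Suc n) s)" .
    from cls_mult_cong[OF refl this, of "const k"]
    have "cls q (const k * (gen GA * ac_mono n s)) = cls q (const (k * inverse q ^ s) * ac_mono (Suc n) s)"
      by (simp add: const_mult mult.assoc)
    with 2 s eq show ?thesis
      by (intro exI[of _ "k * inverse q ^ s"] exI[of _ s]) simp
  qed
qed

lemma keys_ac_mono: "s \<le> n \<Longrightarrow> Poly_Mapping.keys (ac_mono n s) \<subseteq> ac_words n"
proof -
  assume "s \<le> n"
  have "gen x ^ m = word (replicate m x)" for x :: gen and m
  proof (induction m)
    case (Suc m)
    then show ?case
      by (simp add: word_Cons[of x "replicate m x"])
  qed (simp add: word_Nil)
  then have "ac_mono n s = word (replicate s GC @ replicate (n - s) GA)"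
    by (simp add: ac_mono_def word_mult plus_list_def)
  with \<open>s \<le> n\<close> show ?thesis
    by (auto simp: word_def ac_words_def)
qed

text \<open>One inclusion is minimality of the span, the other is normal ordering. The right-hand
  side is the form in which holomorphy and the coaction are checked.\<close>

lemma standard_corep_eq:
  assumes "q \<noteq> 0"
  shows "standard_corep q n = cls q ` {f. Poly_Mapping.keys f \<subseteq> ac_words n}"
proof
  interpret R: ring "SLq q"
    by (rule ring_SLq)
  note K = subfield_scalars[OF assms]
  let ?Us = "map (\<lambda>s. cls q (ac_mono n s)) [0..<Suc n]"
  have Us: "set ?Us \<subseteq> carrier (SLq q)"
    by auto
  show "standard_corep q n \<subseteq> cls q ` {f. Poly_Mapping.keys f \<subseteq> ac_words n}"
    unfolding standard_corep_eq_Span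
  proof (rule R.subalgebra_Span_incl[OF K])
    show "subalgebra (scalars q) (cls q ` {f. Poly_Mapping.keys f \<subseteq> ac_words n}) (SLq q)"
    proof (rule subalgebra_cls_image)
      show "Poly_Mapping.keys (f + g) \<subseteq> ac_words n"
        if "Poly_Mapping.keys f \<subseteq> ac_words n" "Poly_Mapping.keys g \<subseteq> ac_words n" for f g :: free
        using that keys_add[of f g] by blast
      show "Poly_Mapping.keys (const z * f) \<subseteq> ac_words n"
        if "Poly_Mapping.keys f \<subseteq> ac_words n" for z and f :: free
        using that keys_mult[of "const z" f]
        by (auto simp: const_def zero_list_def plus_list_def split: if_splits)
    qed simp
    show "set ?Us \<subseteq> cls q ` {f. Poly_Mapping.keys f \<subseteq> ac_words n}"
      using keys_ac_mono by auto
  qed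
  have "cls q f \<in> standard_corep q n" if "Poly_Mapping.keys f \<subseteq> ac_words n" for f
    using that
  proof (induction rule: supported_induct)
    case zero
    show ?case
      using R.Span_subgroup_props(2)[OF K Us] by (simp only: standard_corep_eq_Span SLq_zero)
  next
    case (add f g)
    then show ?case
      using R.Span_subgroup_props(3)[OF K Us] unfolding standard_corep_eq_Span by (metis SLq_simps(3))
  next
    case (single w z)
    then obtain k s where "s \<le> n" and eq: "cls q (word w) = cls q (const k * ac_mono n s)"
      using cls_ac_word[OF assms] by blast
    then have "cls q (ac_mono n s) \<in> set ?Us"
      by (simp del: upt_Suc)
    then have "cls q (ac_mono n s) \<in> standard_corep q n"
      unfolding standard_corep_eq_Span by (rule subsetD[OF R.Span_base_incl[OF K Us]])
    then have "cls q (const (z * k)) \<otimes>\<^bsub>SLq q\<^esub> cls q (ac_mono n s) \<in> standard_corep q n"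
      unfolding standard_corep_eq_Span
      by (intro R.Span_smult_closed[OF K Us]) (auto simp: scalars_def)
    also have "cls q (const (z * k)) \<otimes>\<^bsub>SLq q\<^esub> cls q (ac_mono n s) = cls q (const z * word w)"
      using cls_mult_cong[OF refl eq, of "const z"] by (simp add: const_mult mult.assoc)
    finally show ?case
      by (simp add: word_single)
  qed
  then show "cls q ` {f. Poly_Mapping.keys f \<subseteq> ac_words n} \<subseteq> standard_corep q n"
    by auto
qed

text \<open>Allowing any list of distinct exponents lets the induction drop the head of the
  list.\<close>

lemma independent_ac_mono:
  assumes "q \<noteq> 0" "distinct ss" "set ss \<subseteq> {..n}"
  shows "ring.independent (SLq q) (scalars q) (map (\<lambda>s. cls q (ac_mono n s)) ss)"
  using assms(2,3)
proof (induction ss)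
  interpret R: ring "SLq q"
    by (rule ring_SLq)
  case Nil
  show ?case
    by (simp add: R.li_Nil)
next
  interpret R: ring "SLq q"
    by (rule ring_SLq)
  case (Cons s ss)
  \<comment> \<open>The coefficient of \<open>x^(n - s)\<close> in the image of \<open>1\<close>
    vanishes for every monomial of the tail but not for the head. By \<open>rep_cong\<close> it does
    not depend on the representative.\<close>
  define P where "P = (\<lambda>f. Poly_Mapping.lookup (rep q f 1) (int n - int s) = 0)"
  have "cls q (ac_mono n s) \<notin> cls q ` {f. P f}"
  proof
    assume "cls q (ac_mono n s) \<in> cls q ` {f. P f}"
    then obtain f where "P f" "cls q (ac_mono n s) = cls q f"
      by auto
    then have "P (ac_mono n s)"
      by (simp add: P_def rep_cong[OF assms(1), of "ac_mono n s" f])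
    then show False
      using Cons.prems assms(1) by (simp add: P_def rep_ac_mono)
  qed
  moreover have "R.Span (scalars q) (map (\<lambda>s. cls q (ac_mono n s)) ss) \<subseteq> cls q ` {f. P f}"
  proof (rule R.subalgebra_Span_incl[OF subfield_scalars[OF assms(1)]])
    have "Poly_Mapping.lookup (const z * v) j = z * Poly_Mapping.lookup v j" for z j and v :: "int \<Rightarrow>\<^sub>0 complex"
      by (induction v rule: pm_induct) (simp_all add: const_times_single lookup_simps distrib_left)
    then show "subalgebra (scalars q) (cls q ` {f. P f}) (SLq q)"
      by (intro subalgebra_cls_image) (simp_all add: P_def lookup_add)
    show "set (map (\<lambda>s. cls q (ac_mono n s)) ss) \<subseteq> cls q ` {f. P f}"
      using Cons.prems by (auto simp: P_def rep_ac_mono lookup_single when_def intro!: imageI)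
  qed
  ultimately have "cls q (ac_mono n s) \<notin> R.Span (scalars q) (map (\<lambda>s. cls q (ac_mono n s)) ss)"
    by blast
  with Cons show ?case
    by (simp add: R.li_Cons del: R.Span.simps)
qed

lemma dimension_standard_corep:
  assumes "q \<noteq> 0"
  shows "ring.dimension (SLq q) (n + 1) (scalars q) (standard_corep q n)"
proof -
  have "distinct [0..<Suc n]" "set [0..<Suc n] \<subseteq> {..n}"
    by auto
  from ring.dimension_independent[OF ring_SLq independent_ac_mono[OF assms this]]
  show ?thesis
    by (simp only: standard_corep_eq_Span length_map length_upt diff_zero Suc_eq_plus1)
qed

section \<open>Coproduct\<close>

lemma tens_superset:
  assumes "finite A" "Poly_Mapping.keys f \<subseteq> A" "finite B" "Poly_Mapping.keys g \<subseteq> B"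
  shows "tens f g = (\<Sum>u\<in>A. \<Sum>v\<in>B.
     Poly_Mapping.single (u, v) (Poly_Mapping.lookup f u * Poly_Mapping.lookup g v))"
proof -
  have "(\<Sum>v\<in>Poly_Mapping.keys g.
      Poly_Mapping.single (u, v) (Poly_Mapping.lookup f u * Poly_Mapping.lookup g v))
    = (\<Sum>v\<in>B. Poly_Mapping.single (u, v) (Poly_Mapping.lookup f u * Poly_Mapping.lookup g v))" for u
    by (rule sum.mono_neutral_left) (use assms in \<open>auto simp: in_keys_iff\<close>)
  then show ?thesis
    unfolding tens_def
    by (simp, intro sum.mono_neutral_left) (use assms in \<open>auto simp: in_keys_iff\<close>)
qed

lemma tens_add_left: "tens (f + f') g = tens f g + tens f' g"
proof -
  let ?A = "Poly_Mapping.keys f \<union> Poly_Mapping.keys f'"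
  have "Poly_Mapping.keys (f + f') \<subseteq> ?A"
    by (rule keys_add)
  then show ?thesis
    by (simp add: tens_superset[of ?A _ "Poly_Mapping.keys g"] lookup_add distrib_right single_add
        sum.distrib)
qed

lemma tens_add_right: "tens f (g + g') = tens f g + tens f g'"
proof -
  let ?B = "Poly_Mapping.keys g \<union> Poly_Mapping.keys g'"
  have "Poly_Mapping.keys (g + g') \<subseteq> ?B"
    by (rule keys_add)
  then show ?thesis
    by (simp add: tens_superset[of "Poly_Mapping.keys f" _ ?B] lookup_add distrib_left single_add
        sum.distrib)
qed

lemma tens_0 [simp]: "tens 0 g = 0" "tens f 0 = 0"
  by (simp_all add: tens_def)

lemma tens_uminus: "tens (- f) g = - tens f g" "tens f (- g) = - tens f g"
  using tens_add_left[of f "- f" g] tens_add_right[of f g "- g"]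
  by (simp_all add: eq_neg_iff_add_eq_0 add.commute)

lemma tens_diff: "tens (f - f') g = tens f g - tens f' g" "tens f (g - g') = tens f g - tens f g'"
  using tens_add_left[of f "- f'" g] tens_add_right[of f g "- g'"] by (simp_all add: tens_uminus)

lemma tens_single: "tens (Poly_Mapping.single u x) (Poly_Mapping.single v y)
    = Poly_Mapping.single (u, v) (x * y)"
  by (simp add: tens_superset[of "{u}" _ "{v}"])

lemma free_coprod_simps [simp]:
  "free_coprod 0 = 0"
  "free_coprod (f + g) = free_coprod f + free_coprod g"
  "free_coprod (f - g) = free_coprod f - free_coprod g"
  "free_coprod (const z) = const z"
  "free_coprod 1 = 1"
  "free_coprod (gen x) = coprod_gen x"
  by (simp_all add: free_coprod_def lin_ext_add lin_ext_diff free_one_single)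
    (simp add: const_def zero_list_def)

lemma free_coprod_mult [simp]: "free_coprod (f * g) = free_coprod f * free_coprod g"
proof (induction f rule: pm_induct)
  case (single u x)
  show ?case
  proof (induction g rule: pm_induct)
    case (single v y)
    show ?case
      unfolding free_coprod_def mult_single plus_list_def
      by (simp add: const_mult const_left_commute[of "prod_list _"] mult.assoc)
  qed (simp_all add: distrib_left)
qed (simp_all add: distrib_right)

section \<open>Descent of the coproduct and of pure tensors\<close>

interpretation sl2_sl2: type_ideal "sl2_ideal2 q" for q
  unfolding sl2_ideal2_def by (rule type_ideal_genideal)

lemma tens_ideal2:
  "f \<in> sl2_ideal q \<Longrightarrow> tens f g \<in> sl2_ideal2 q" "g \<in> sl2_ideal q \<Longrightarrow> tens f g \<in> sl2_ideal2 q"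
  unfolding sl2_ideal2_def by (rule genideal_TA_incl, blast)+

lemma free2_one_single: "(1 :: free2) = Poly_Mapping.single ([], []) 1"
  by (simp add: zero_list_def zero_prod_def flip: single_one)

lemmas tens_monomial_simps = rel_defs tens_add_left tens_add_right tens_diff tens_uminus tens_single
  free_one_single free2_one_single monomial_simps zero_prod_def plus_prod_def

text \<open>The coproduct of a relator is a sum of tensors with a relator in one factor. In the
  first case, collecting by monomials of the left factor leaves relators on the right, and the
  constants in the relations for \<open>ad\<close> and \<open>da\<close> combine into
  \<open>tens (rel_ba q) 1\<close>.\<close>

lemma free_coprod_relators:
  assumes "q \<noteq> 0"
  shows
  "free_coprod (rel_ba q) = tens (gen GA * gen GA) (rel_ba q) + tens (gen GB * gen GB) (rel_dc q)
     + tens (gen GB * gen GA) (rel_da q + const q * rel_bc)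
     - tens (const q * (gen GA * gen GB)) (rel_ad q) + tens (rel_ba q) 1"
  "free_coprod (rel_ca q) = tens (rel_ca q) (gen GA * gen GA) + tens (rel_db q) (gen GC * gen GC)
     + tens (rel_da q) (gen GC * gen GA) - tens (rel_bc + const q * rel_ad q) (gen GA * gen GC)
     + tens 1 (rel_ca q)"
  "free_coprod (rel_db q) = tens (rel_ca q) (gen GB * gen GB) + tens (rel_db q) (gen GD * gen GD)
     + tens (rel_da q) (gen GD * gen GB) - tens (rel_bc + const q * rel_ad q) (gen GB * gen GD)
     + tens 1 (rel_db q)"
  "free_coprod (rel_dc q) = tens (gen GC * gen GC) (rel_ba q) + tens (gen GD * gen GD) (rel_dc q)
     + tens (gen GD * gen GC) (rel_da q + const q * rel_bc)
     - tens (const q * (gen GC * gen GD)) (rel_ad q) + tens (rel_dc q) 1"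
  "free_coprod rel_bc = tens (gen GA * gen GC) (rel_ba q) - tens (rel_ca q) (gen GA * gen GB)
     + tens (gen GB * gen GD) (rel_dc q) - tens (rel_db q) (gen GC * gen GD)
     + tens (rel_ad q) (gen GB * gen GC) - tens (rel_da q) (gen GC * gen GB)
     + tens (gen GB * gen GC) (rel_da q) + tens rel_bc (gen GA * gen GD)
     - tens (gen GB * gen GC) (rel_ad q) + tens (1 + const q * (gen GB * gen GC)) rel_bc"
  "free_coprod (rel_ad q) = tens (rel_ad q) 1 + tens (gen GA * gen GD) (rel_ad q)
     - tens (gen GB * gen GC) (rel_bc + const (inverse q) * rel_da q)
     - tens (const (inverse q) * (gen GA * gen GC)) (rel_ba q)
     - tens (const (inverse q) * (gen GB * gen GD)) (rel_dc q)"
  "free_coprod (rel_da q) = tens (rel_ca q) (gen GB * gen GA) + tens (rel_db q) (gen GD * gen GC)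
     - tens (rel_bc + const q * rel_ad q) (gen GB * gen GC) + tens (rel_da q) (gen GD * gen GA)
     + tens 1 (rel_da q)"
  using assms
  by (simp_all only: rel_defs free_coprod_simps free_coprod_mult coprod_gen.simps)
    (simp_all add: tens_monomial_simps ring_distribs)

lemma free_coprod_ideal:
  assumes "q \<noteq> 0" "f \<in> sl2_ideal q"
  shows "free_coprod f \<in> sl2_ideal2 q"
proof -
  have "sl2_ideal q \<subseteq> {f. free_coprod f \<in> sl2_ideal2 q}"
  proof (rule sl2_ideal_subset)
    show "r \<in> {f. free_coprod f \<in> sl2_ideal2 q}" if "r \<in> sl2_relators q" for r
      using that unfolding sl2_relators_eq mem_Collect_eq
      by (elim insertE emptyE)
        (simp_all add: free_coprod_relators[OF assms(1)] sl2_sl2.mem_add sl2_sl2.mem_diff tens_ideal2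
          sl2.mem_add sl2.mem_lmul sl2_relator_mem)
  qed (simp_all add: sl2_sl2.mem_add sl2_sl2.mem_lmul sl2_sl2.mem_rmul)
  with assms(2) show ?thesis by auto
qed

lemma cls2_eq_iff: "cls2 q f = cls2 q g \<longleftrightarrow> f - g \<in> sl2_ideal2 q"
  by (simp add: cls2_def sl2_sl2.coset_eq_iff)

lemma SLq2_simps:
  "cls2 q f \<oplus>\<^bsub>SLq2 q\<^esub> cls2 q g = cls2 q (f + g)"
  "\<zero>\<^bsub>SLq2 q\<^esub> = cls2 q 0"
  by (simp_all add: SLq2_def cls2_def sl2_sl2.quot_add sl2_sl2.quot_zero)

lemma coproduct_cls:
  assumes "q \<noteq> 0"
  shows "coproduct q (cls q f) = cls2 q (free_coprod f)"
  unfolding coproduct_def cls_def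
  by (rule sl2.the_elem_coset) (simp add: cls2_eq_iff free_coprod_ideal[OF assms])

lemma pure_tensor_cls: "pure_tensor q (cls q f) (cls q g) = cls2 q (tens f g)"
proof -
  have "cls2 q (tens (i + f) (j + g)) = cls2 q (tens f g)"
    if "i \<in> sl2_ideal q" "j \<in> sl2_ideal q" for i j
  proof -
    \<comment> \<open>A change of both representatives only adds tensors with one factor in the
      ideal of relations.\<close>
    have "tens (i + f) (j + g) - tens f g = tens i (j + g) + tens f j"
      by (simp add: tens_add_left tens_add_right)
    then show ?thesis
      using that by (simp add: cls2_eq_iff sl2_sl2.mem_add tens_ideal2)
  qed
  moreover have cls: "cls q h = {i + h | i. i \<in> sl2_ideal q}" for h
    by (simp add: cls_def sl2.coset_unfold)
  ultimately have "(\<lambda>(f, g). cls2 q (tens f g)) ` (cls q f \<times> cls q g) \<subseteq> {cls2 q (tens f g)}"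
    by auto
  moreover have "cls q f \<times> cls q g \<noteq> {}"
    unfolding cls using sl2.mem_zero[of q] by blast
  ultimately have "(\<lambda>(f, g). cls2 q (tens f g)) ` (cls q f \<times> cls q g) = {cls2 q (tens f g)}"
    by (simp add: subset_singleton_iff)
  then show ?thesis
    by (simp add: pure_tensor_def)
qed

section \<open>The coaction on words in \<open>a\<close> and \<open>c\<close>\<close>

lemma keys_const_mult:
  "Poly_Mapping.keys (const z * f) \<subseteq> Poly_Mapping.keys (f :: 'w::monoid_add \<Rightarrow>\<^sub>0 complex)"
  using keys_mult[of "const z" f] by (auto simp: const_def split: if_splits)

text \<open>The right factors in the coproducts of \<open>a\<close> and \<open>c\<close> are
  \<open>a\<close> and \<open>c\<close> themselves. Multiplicativity concatenates them to words of
  the same length.\<close>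

lemma keys_coprod_ac_word:
  assumes "w \<in> ac_words n"
  shows "Poly_Mapping.keys (free_coprod (word w)) \<subseteq> UNIV \<times> ac_words n"
  using assms
proof (induction rule: ac_words_induct)
  case Nil
  show ?case
    by (simp add: word_Nil free2_one_single ac_words_0)
next
  case (Cons n x w)
  have x: "Poly_Mapping.keys (coprod_gen x) \<subseteq> UNIV \<times> {[GA], [GC]}"
    using Cons(1) by (auto simp: word_def tens_single dest!: subsetD[OF keys_add])
  have "v + w' \<in> UNIV \<times> ac_words (Suc n)"
    if "v \<in> UNIV \<times> {[GA], [GC]}" "w' \<in> UNIV \<times> ac_words n" for v w' :: "gen list \<times> gen list"
    using that by (auto simp: plus_prod_def plus_list_def ac_words_Suc)
  moreover have "Poly_Mapping.keys (free_coprod (word (x # w)))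
      \<subseteq> {v + w' | v w'. v \<in> Poly_Mapping.keys (coprod_gen x) \<and> w' \<in> Poly_Mapping.keys (free_coprod (word w))}"
    unfolding word_Cons[of x w] free_coprod_mult free_coprod_simps by (rule keys_mult)
  ultimately show ?case
    using x Cons.IH by blast
qed

lemma coproduct_standard_corep:
  assumes "q \<noteq> 0"
  shows "coproduct q ` standard_corep q n \<subseteq> SLq_tensor q (standard_corep q n)"
proof -
  let ?V = "cls q ` {f. Poly_Mapping.keys f \<subseteq> ac_words n}"
  have tensor: "cls2 q h \<in> SLq_tensor q ?V" if "Poly_Mapping.keys h \<subseteq> UNIV \<times> ac_words n" for h
    using that
  proof (induction rule: supported_induct)
    case zero
    show ?case
      using generate.one[of "add_monoid (SLq2 q)"] by (simp add: SLq_tensor_def SLq2_simps)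
  next
    case (add h h')
    then show ?case
      using generate.eng[of "cls2 q h" "add_monoid (SLq2 q)" _ "cls2 q h'"]
      by (simp add: SLq_tensor_def SLq2_simps)
  next
    case (single p z)
    obtain u v where p: "p = (u, v)" "v \<in> ac_words n"
      using single by auto
    \<comment> \<open>\<open>SLq_tensor\<close> is generated as an additive group only, so the
      scalar \<open>z\<close> is absorbed into the left factor.\<close>
    have "cls2 q (Poly_Mapping.single p z) = pure_tensor q (cls q (Poly_Mapping.single u z)) (cls q (word v))"
      by (simp add: pure_tensor_cls word_def tens_single p)
    moreover have "cls q (word v) \<in> ?V"
      using p by (auto simp: word_def)
    ultimately show ?case
      unfolding SLq_tensor_def by (intro generate.incl CollectI exI[of _ "cls q (Poly_Mapping.single u z)"]
        exI[of _ "cls q (word v)"] conjI SLq_simps(1))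
  qed
  have "Poly_Mapping.keys (free_coprod f) \<subseteq> UNIV \<times> ac_words n" if "Poly_Mapping.keys f \<subseteq> ac_words n" for f
    using that
  proof (induction rule: supported_induct)
    case (add f g)
    then show ?case
      using keys_add[of "free_coprod f" "free_coprod g"] unfolding free_coprod_simps by blast
  next
    case (single w z)
    then show ?case
      using keys_coprod_ac_word[OF single] keys_const_mult[of z "free_coprod (word w)"]
      by (simp add: free_coprod_def subset_trans)
  qed simp
  with tensor show ?thesis
    by (auto simp: standard_corep_eq[OF assms] coproduct_cls[OF assms])
qed

theorem propositionA1:
  fixes q :: complex and n :: nat
  assumes "q \<noteq> 0"
  shows "standard_corep q n \<subseteq> hol_sections q n
    \<and> left_subcomodule q (monopole q n) (standard_corep q n)
    \<and> ring.dimension (SLq q) (n + 1) (scalars q) (standard_corep q n)"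
proof (intro conjI)
  show hol: "standard_corep q n \<subseteq> hol_sections q n"
    using ac_holomorphic[OF assms] by (auto simp: standard_corep_eq[OF assms])
  have "subalgebra (scalars q) (standard_corep q n) (SLq q)"
    unfolding standard_corep_eq_Span
    by (rule ring.Span_is_subalgebra[OF ring_SLq subfield_scalars[OF assms]]) auto
  moreover have "standard_corep q n \<subseteq> monopole q n"
    using hol by (auto simp: hol_sections_def)
  ultimately show "left_subcomodule q (monopole q n) (standard_corep q n)"
    unfolding left_subcomodule_def using coproduct_standard_corep[OF assms] by blast
  show "ring.dimension (SLq q) (n + 1) (scalars q) (standard_corep q n)"
    by (rule dimension_standard_corep[OF assms])
qed

end
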